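(* Let $d\ge 1$ be an integer and let $s$ be an integer with $0\le s\le \lfloor d/2\rfloor$. Then, for real $B\ge 1$, $$D_d^*(s,B)=\lambda_{d+1}(\mathcal H_d(s))\,B^{d+1}+O(B^{d}),$$ where the implied constant depends only on $d$ and $s$ (not on $B$). Moreover, $\lambda_{d+1}(\mathcal H_d(s))>0$ for all such $d$ and $s$.
   Context: A real polynomial $P(X)=p_dX^d+\dots+p_0\in\mathbb R[X]$ with $p_d\ne 0$ is said to have signature $s$ if, counting roots with multiplicity, it has exactly $s$ pairs of complex conjugate non-real roots (and hence exactly $r=d-2s$ real roots). For real $B>0$, $\mathcal H_d(s,B)$ denotes the set of vectors $(p_0,\dots,p_d)\in\mathbb R^{d+1}$ with $p_d\neq 0$ and $|p_i|\le B$ for $0\le i\le d$, such that $p_dX^d+\dots+p_0$ has signature $s$; put $\mathcal H_d(s):=\mathcal H_d(s,1)$. $D_d^*(s,B)$ denotes the number of polynomials $p_dX^d+p_{d-1}X^{d-1}+\dots+p_0\in\mathbb Z[X]$ with integer coefficients, $p_d\ne 0$, $|p_i|\le B$ for $i=0,\dots,d$, and signature $s$. $\lambda_{n}$ denotes Lebesgue measure on $\mathbb R^{n}$. *)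

theory Defs
  imports "HOL-Analysis.Analysis" "HOL-Computational_Algebra.Polynomial"
begin

text \<open>
  Non-real roots of a real polynomial come in conjugate pairs of equal multiplicity, so having
  exactly s such pairs (with multiplicity) means that the multiplicities of the non-real complex
  roots add up to 2 * s.
\<close>
definition has_signature :: "real poly \<Rightarrow> nat \<Rightarrow> bool" where
  "has_signature P s \<longleftrightarrow> P \<noteq> 0 \<and>
     (let Q = map_poly complex_of_real P
      in (\<Sum>z | poly Q z = 0 \<and> z \<notin> \<real>. order z Q) = 2 * s)"

text \<open>
  Euclidean n-space is rendered as the extensional functions on the index set {..<n}, and Lebesgue
  measure on it as the completion of the n-fold product of one-dimensional Lebesgue-Borel measure.
\<close>
definition lebesgue_n :: "nat \<Rightarrow> (nat \<Rightarrow> real) measure" where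
  "lebesgue_n n = completion (PiM {..<n} (\<lambda>_. lborel))"

definition H_set :: "nat \<Rightarrow> nat \<Rightarrow> real \<Rightarrow> (nat \<Rightarrow> real) set" where
  "H_set d s B = {p \<in> {..<d + 1} \<rightarrow>\<^sub>E UNIV.
     p d \<noteq> 0 \<and> (\<forall>i\<le>d. \<bar>p i\<bar> \<le> B) \<and> has_signature (\<Sum>i\<le>d. monom (p i) i) s}"

definition D_star :: "nat \<Rightarrow> nat \<Rightarrow> real \<Rightarrow> nat" where
  "D_star d s B = card {P :: int poly.
     degree P = d \<and> coeff P d \<noteq> 0 \<and> (\<forall>i\<le>d. \<bar>real_of_int (coeff P i)\<bar> \<le> B) \<and>
     has_signature (map_poly real_of_int P) s}"

end

theory Submission
  imports Defs "HOL-Computational_Algebra.Fundamental_Theorem_Algebra"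
begin

text \<open>
  Cut coefficient space into half-open cubes of side \<open>1 / B\<close> whose corners are the integer
  vectors divided by \<open>B\<close>. Both \<open>D_star d s B\<close> and \<open>B ^ (d + 1)\<close> times the volume lie between the
  number of cubes contained in the region and the number of cubes meeting it, so it suffices to
  bound the number of cubes which meet the region without being contained in it by \<open>O(B ^ d)\<close>.
  The number of real roots is locally constant among polynomials of degree \<open>d\<close> without a real
  double root. Hence such a cube touches a face of the box or the hyperplane \<open>p d = 0\<close>, or it contains a
  polynomial with a real double root \<open>x\<close>. If \<open>\<bar>x\<bar> \<le> 1\<close>, the two lowest coefficients of this polynomial
  are Lipschitz functions of \<open>x\<close> and of the others, which leaves \<open>O(B ^ d)\<close> cubes; if \<open>\<bar>x\<bar> > 1\<close>,
  reverse the coefficients. The volume is positive because a product of distinct real linear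
  factors and a power of \<open>X\<^sup>2 + 1\<close> is an interior point of the region, up to scaling.
\<close>

section \<open>Stability of the number of real roots\<close>

lemma same_sign_if_no_zero:
  fixes h :: "real \<Rightarrow> real"
  assumes "continuous_on {a..b} h" "\<And>x. x \<in> {a..b} \<Longrightarrow> h x \<noteq> 0" "u \<in> {a..b}" "v \<in> {a..b}"
  shows "0 < h u * h v"
proof (rule ccontr)
  assume "\<not> 0 < h u * h v"
  then have *: "(h u \<le> 0 \<and> 0 \<le> h v) \<or> (h v \<le> 0 \<and> 0 \<le> h u)"
    by (auto simp: zero_less_mult_iff not_less)
  have conn: "connected (h ` {a..b})"
    by (intro connected_continuous_image assms) auto
  have "0 \<in> h ` {a..b}"
    using * connectedD_interval[OF conn, of "h u" "h v" 0] connectedD_interval[OF conn, of "h v" "h u" 0] assms(3,4)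
    by auto
  then show False using assms(2) by auto
qed

text \<open>On the interval \<open>h'\<close> keeps one sign, so \<open>h\<close> moves by at least
  \<open>c * \<rho>\<close> in opposite directions on the two sides of \<open>y\<close>. This
  exceeds \<open>\<bar>h y\<bar>\<close>, so \<open>h\<close> changes sign.\<close>

lemma zero_near_if_derivative_large:
  fixes h h' :: "real \<Rightarrow> real"
  assumes deriv: "\<And>x. (h has_real_derivative h' x) (at x)"
    and cont: "continuous_on {y - \<rho>..y + \<rho>} h'"
    and large: "\<And>x. x \<in> {y - \<rho>..y + \<rho>} \<Longrightarrow> c \<le> \<bar>h' x\<bar>"
    and small: "\<bar>h y\<bar> < c * \<rho>" and "\<rho> > 0" "c > 0"
  shows "\<exists>z\<in>{y - \<rho>..y + \<rho>}. h z = 0"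
proof (rule ccontr)
  assume "\<not> ?thesis"
  then have nz: "\<And>x. x \<in> {y - \<rho>..y + \<rho>} \<Longrightarrow> h x \<noteq> 0" by auto
  have conth: "continuous_on {y - \<rho>..y + \<rho>} h"
    using deriv by (meson DERIV_atLeastAtMost_imp_continuous_on)
  have nz': "\<And>x. x \<in> {y - \<rho>..y + \<rho>} \<Longrightarrow> h' x \<noteq> 0" using large \<open>c > 0\<close> by force
  obtain u where u: "y < u" "u < y + \<rho>" "h (y + \<rho>) - h y = (y + \<rho> - y) * h' u"
    using MVT2[of y "y + \<rho>" h h'] deriv \<open>\<rho> > 0\<close> by auto
  obtain v where v: "y - \<rho> < v" "v < y" "h y - h (y - \<rho>) = (y - (y - \<rho>)) * h' v"
    using MVT2[of "y - \<rho>" y h h'] deriv \<open>\<rho> > 0\<close> by auto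
  have h'h': "0 < h' u * h' v"
    by (rule same_sign_if_no_zero[OF cont nz']) (use u v in auto)
  have hh: "0 < h y * h (y + \<rho>)" "0 < h y * h (y - \<rho>)"
    by (rule same_sign_if_no_zero[OF conth nz]; use \<open>\<rho> > 0\<close> in auto)+
  then have "(0 < h y \<and> 0 < h (y + \<rho>) \<and> 0 < h (y - \<rho>)) \<or> (h y < 0 \<and> h (y + \<rho>) < 0 \<and> h (y - \<rho>) < 0)"
    by (auto simp: zero_less_mult_iff)
  moreover have "c * \<rho> \<le> \<bar>\<rho> * h' u\<bar>" "c * \<rho> \<le> \<bar>\<rho> * h' v\<bar>"
    using large[of u] large[of v] u v \<open>\<rho> > 0\<close> by (simp_all add: abs_mult mult.commute)
  moreover have "(\<rho> * h' u > 0 \<and> \<rho> * h' v > 0) \<or> (\<rho> * h' u < 0 \<and> \<rho> * h' v < 0)"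
    using h'h' \<open>\<rho> > 0\<close> by (auto simp: zero_less_mult_iff mult_less_0_iff)
  moreover have "h (y + \<rho>) - h y = \<rho> * h' u" "h y - h (y - \<rho>) = \<rho> * h' v"
    using u(3) v(3) by simp_all
  ultimately show False
    using small by linarith
qed

text \<open>Sending each zero of \<open>g\<close> to a zero of \<open>h\<close> within distance
  \<open>\<rho>\<close> is injective, because distinct zeros of \<open>g\<close> are more than
  \<open>2 * \<rho>\<close> apart. Neither \<open>g\<close> nor \<open>h\<close> is fixed to be
  \<open>f\<close>, so that exchanging them can turn the inequality into an equality.\<close>

lemma card_zeros_le_if_C1_close:
  fixes f f' :: "real \<Rightarrow> real"
  assumes deriv: "\<And>x. (f has_real_derivative f' x) (at x)"
    and cont: "continuous_on UNIV f'"
    and simple: "\<And>x. x \<in> {- R - 1..R + 1} \<Longrightarrow> f x \<noteq> 0 \<or> f' x \<noteq> 0" and "R \<ge> 0"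
  obtains e where "e > 0"
    "\<And>x g g'. \<lbrakk>x \<in> {- R - 1..R + 1}; \<bar>g x - f x\<bar> < e; \<bar>g' x - f' x\<bar> < e\<rbrakk> \<Longrightarrow> g x \<noteq> 0 \<or> g' x \<noteq> 0"
    "\<And>g g' h h'. \<lbrakk>\<And>x. (g has_real_derivative g' x) (at x); \<And>x. (h has_real_derivative h' x) (at x);
       continuous_on UNIV h';
       \<And>x. x \<in> {- R - 1..R + 1} \<Longrightarrow> \<bar>g x - f x\<bar> < e \<and> \<bar>g' x - f' x\<bar> < e \<and> \<bar>h x - f x\<bar> < e \<and> \<bar>h' x - f' x\<bar> < e;
       \<And>x. g x = 0 \<Longrightarrow> \<bar>x\<bar> \<le> R; finite {x. h x = 0}\<rbrakk>
       \<Longrightarrow> card {x. g x = 0} \<le> card {x. h x = 0}"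
proof -
  let ?K = "{- R - 1..R + 1}"
  have contf: "continuous_on ?K f"
    using deriv by (meson DERIV_atLeastAtMost_imp_continuous_on)
  have contf': "continuous_on ?K f'" using cont continuous_on_subset by blast
  have "continuous_on ?K (\<lambda>x. \<bar>f x\<bar> + \<bar>f' x\<bar>)"
    by (intro continuous_intros contf contf')
  then obtain x0 where x0: "x0 \<in> ?K" "\<And>x. x \<in> ?K \<Longrightarrow> \<bar>f x0\<bar> + \<bar>f' x0\<bar> \<le> \<bar>f x\<bar> + \<bar>f' x\<bar>"
    using continuous_attains_inf[of ?K "\<lambda>x. \<bar>f x\<bar> + \<bar>f' x\<bar>"] \<open>R \<ge> 0\<close>
    by fastforce
  define m where "m = \<bar>f x0\<bar> + \<bar>f' x0\<bar>"
  have m: "m > 0" "\<And>x. x \<in> ?K \<Longrightarrow> m \<le> \<bar>f x\<bar> + \<bar>f' x\<bar>"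
    using simple[OF x0(1)] x0(2) by (auto simp: m_def)
  have "bounded (f' ` ?K)"
    by (intro compact_imp_bounded compact_continuous_image contf') auto
  then obtain L where L: "L > 0" "\<And>x. x \<in> ?K \<Longrightarrow> \<bar>f' x\<bar> \<le> L"
    by (auto simp: bounded_pos)
  have "uniformly_continuous_on ?K f'"
    by (intro compact_uniformly_continuous contf') auto
  then obtain r where r: "r > 0" "\<And>x y. \<lbrakk>x \<in> ?K; y \<in> ?K; dist x y < r\<rbrakk> \<Longrightarrow> dist (f' x) (f' y) < m / 4"
    unfolding uniformly_continuous_on_def using m(1) by (metis zero_less_divide_iff zero_less_numeral)
  \<comment> \<open>The bound 1 keeps the \<open>\<rho>\<close>-neighbourhood of a zero of
    \<open>g\<close> inside \<open>?K\<close>, \<open>r / 2\<close> makes \<open>f'\<close> vary by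
    less than \<open>m / 4\<close> from its value at that zero, and \<open>m / (8 * L)\<close> lets
    \<open>f\<close> vary by at most \<open>m / 4\<close> over a distance
    \<open>2 * \<rho>\<close>.\<close>
  define \<rho> where "\<rho> = min 1 (min (r / 2) (m / (8 * L)))"
  have \<rho>: "\<rho> > 0" "\<rho> \<le> 1" "\<rho> < r" "\<rho> \<le> m / (8 * L)"
    using m(1) L(1) r(1) by (auto simp: \<rho>_def)
  have \<rho>L: "8 * L * \<rho> \<le> m" using \<rho>(4) L(1) by (simp add: field_simps)
  \<comment> \<open>Two errors of size \<open>e\<close> may cost at most \<open>m / 4\<close> in the
    lower bound for \<open>\<bar>h' x\<bar>\<close> and at most \<open>m / 2 * \<rho>\<close> in the
    upper bound for \<open>\<bar>h y\<bar>\<close>.\<close>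
  define e where "e = min (m / 8) (m * \<rho> / 4)"
  have e: "e > 0" "e \<le> m / 8" "e \<le> m * \<rho> / 4" using m(1) \<rho>(1) by (auto simp: e_def)
  have simple': "g x \<noteq> 0 \<or> g' x \<noteq> 0"
    if "x \<in> ?K" "\<bar>g x - f x\<bar> < e" "\<bar>g' x - f' x\<bar> < e" for x and g g' :: "real \<Rightarrow> real"
    using m(2)[OF that(1)] that(2,3) e m(1) by linarith
  have close: "card {x. g x = 0} \<le> card {x. h x = 0}"
    if dg: "\<And>x. (g has_real_derivative g' x) (at x)" and dh: "\<And>x. (h has_real_derivative h' x) (at x)"
    and ch: "continuous_on UNIV h'"
    and cl: "\<And>x. x \<in> ?K \<Longrightarrow> \<bar>g x - f x\<bar> < e \<and> \<bar>g' x - f' x\<bar> < e \<and> \<bar>h x - f x\<bar> < e \<and> \<bar>h' x - f' x\<bar> < e"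
    and zg: "\<And>x. g x = 0 \<Longrightarrow> \<bar>x\<bar> \<le> R" and fin: "finite {x. h x = 0}" for g g' h h'
  proof -
    have ex: "\<exists>z\<in>{y - \<rho>..y + \<rho>}. h z = 0" if y: "g y = 0" for y
    proof (rule zero_near_if_derivative_large[of h h'])
      have yK: "y \<in> ?K" using zg[OF y] by auto
      have sub: "{y - \<rho>..y + \<rho>} \<subseteq> ?K" using zg[OF y] \<rho>(2) by auto
      have fy: "\<bar>f y\<bar> < e" using cl[OF yK] y by auto
      \<comment> \<open>Since \<open>f y\<close> is small, \<open>f' y\<close> carries almost all of
        the lower bound \<open>m\<close>; the total loss on the way to \<open>h' x\<close> is at
        most \<open>e + m / 4 + e\<close>.\<close>
      show "m / 2 \<le> \<bar>h' x\<bar>" if "x \<in> {y - \<rho>..y + \<rho>}" for x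
      proof -
        have "x \<in> ?K" using that sub by auto
        moreover have "\<bar>f' x - f' y\<bar> < m / 4"
          using r(2)[OF \<open>x \<in> ?K\<close> yK] that \<rho>(3) by (auto simp: dist_real_def)
        ultimately show ?thesis using cl[of x] m(2)[OF yK] fy e by linarith
      qed
      show "\<bar>h y\<bar> < m / 2 * \<rho>" using fy cl[OF yK] e(3) by linarith
    qed (use dh ch \<rho> m in \<open>auto intro: continuous_on_subset\<close>)
    \<comment> \<open>Between two close zeros of \<open>g\<close> there is a zero \<open>c\<close>
      of \<open>g'\<close>. Then \<open>f c\<close> and \<open>f' c\<close> are both small, against
      the lower bound \<open>m\<close>.\<close>
    have sep: "y1 = y2" if y: "g y1 = 0" "g y2 = 0" "\<bar>y1 - y2\<bar> \<le> 2 * \<rho>" for y1 y2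
    proof -
      have False if ab: "a < b" "g a = 0" "g b = 0" "b - a \<le> 2 * \<rho>" for a b
      proof -
        obtain c where c: "a < c" "c < b" "g b - g a = (b - a) * g' c"
          using MVT2[of a b g g'] dg ab by auto
        then have g'c: "g' c = 0" using ab by auto
        have K: "a \<in> ?K" "b \<in> ?K" "c \<in> ?K" using zg[of a] zg[of b] ab c by auto
        obtain w where w: "a < w" "w < c" "f c - f a = (c - a) * f' w"
          using MVT2[of a c f f'] deriv c by auto
        have "w \<in> ?K" using w K by auto
        then have "\<bar>f c - f a\<bar> \<le> (c - a) * L"
          using w L by (auto simp: abs_mult intro!: mult_mono)
        also have "\<dots> \<le> 2 * \<rho> * L"
          using c ab L by (intro mult_right_mono) auto
        also have "\<dots> \<le> m / 4" using \<rho>L by (simp add: algebra_simps)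
        finally have 1: "\<bar>f c - f a\<bar> \<le> m / 4" .
        have 2: "\<bar>f a\<bar> < e" using cl[OF K(1)] ab(2) by simp
        have "\<bar>f' c\<bar> < e" using cl[OF K(3)] g'c by simp
        then show False using 1 2 m(2)[OF K(3)] e(2) m(1) by linarith
      qed
      from this[of y1 y2] this[of y2 y1] show ?thesis using y
        by (cases y1 y2 rule: linorder_cases) simp_all
    qed
    obtain \<phi> where \<phi>: "\<And>y. g y = 0 \<Longrightarrow> \<phi> y \<in> {y - \<rho>..y + \<rho>} \<and> h (\<phi> y) = 0"
      using ex by metis
    show ?thesis
    proof (rule card_inj_on_le[OF _ _ fin])
      show "inj_on \<phi> {x. g x = 0}"
      proof (rule inj_onI)
        fix a b assume ab: "a \<in> {x. g x = 0}" "b \<in> {x. g x = 0}" "\<phi> a = \<phi> b"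
        have "a - \<rho> \<le> \<phi> a" "\<phi> a \<le> a + \<rho>" using \<phi>[of a] ab(1) by simp_all
        moreover have "b - \<rho> \<le> \<phi> a" "\<phi> a \<le> b + \<rho>" using \<phi>[of b] ab(2,3) by simp_all
        ultimately have "\<bar>a - b\<bar> \<le> 2 * \<rho>" by linarith
        then show "a = b" using ab by (metis (mono_tags, lifting) mem_Collect_eq sep)
      qed
    qed (use \<phi> in auto)
  qed
  show thesis
    by (rule that[OF e(1)]; (rule simple' | rule close); assumption)
qed

section \<open>The signature in terms of the number of real roots\<close>

lemma order_simple_root:
  fixes P :: "'a::field_char_0 poly"
  assumes "poly P x = 0" "poly (pderiv P) x \<noteq> 0"
  shows "order x P = 1"
proof -
  have "P \<noteq> 0" using assms by auto
  have "order x P \<noteq> 0" using assms \<open>P \<noteq> 0\<close> by (simp add: order_eq_0_iff)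
  moreover have "pderiv P \<noteq> 0" using assms by auto
  moreover have "order x (pderiv P) = 0" using assms(2) by (rule order_0I)
  ultimately show ?thesis using order_pderiv[of P x] \<open>P \<noteq> 0\<close> assms(1) by simp
qed

lemma poly_map_of_real: "poly (map_poly complex_of_real P) (of_real x) = of_real (poly P x)"
  by (induction P) (auto simp: map_poly_pCons)

lemma pderiv_map_of_real: "pderiv (map_poly complex_of_real P) = map_poly complex_of_real (pderiv P)"
  by (intro poly_eqI) (auto simp: coeff_pderiv coeff_map_poly)

text \<open>The orders of all complex roots add up to the degree, and each real root contributes
  exactly 1. Non-real roots may still be multiple.\<close>

lemma has_signature_iff_card_real_roots:
  assumes "P \<noteq> 0" and simple: "\<And>x. poly P x = 0 \<Longrightarrow> poly (pderiv P) x \<noteq> 0"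
  shows "has_signature P s \<longleftrightarrow> card {x. poly P x = 0} + 2 * s = degree P"
proof -
  define Q where "Q = map_poly complex_of_real P"
  have Q: "Q \<noteq> 0" "degree Q = degree P"
    using assms(1) by (auto simp: Q_def map_poly_eq_0_iff degree_map_poly)
  have fin: "finite {z. poly Q z = 0}" using Q by (simp add: poly_roots_finite)
  have real: "{z. poly Q z = 0 \<and> z \<in> \<real>} = of_real ` {x. poly P x = 0}"
    by (auto simp: Q_def poly_map_of_real elim!: Reals_cases)
  have ord: "order (of_real x) Q = 1" if "poly P x = 0" for x
    using that simple[OF that]
    by (intro order_simple_root) (simp_all add: Q_def poly_map_of_real pderiv_map_of_real)
  have "degree P = (\<Sum>z | poly Q z = 0. order z Q)"
    using size_proots_complex[of Q] Q by (simp add: size_multiset_overloaded_eq)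
  also have "\<dots> = (\<Sum>z | poly Q z = 0 \<and> z \<in> \<real>. order z Q) + (\<Sum>z | poly Q z = 0 \<and> z \<notin> \<real>. order z Q)"
    by (subst sum.union_disjoint[symmetric]) (auto intro!: sum.cong finite_subset[OF _ fin])
  also have "(\<Sum>z | poly Q z = 0 \<and> z \<in> \<real>. order z Q) = (\<Sum>x | poly P x = 0. 1)"
    unfolding real by (subst sum.reindex) (auto simp: ord inj_on_def)
  finally show ?thesis
    using assms(1) by (auto simp: has_signature_def Q_def[symmetric] Let_def)
qed

lemma has_signature_smult:
  assumes "c \<noteq> 0"
  shows "has_signature (smult c P) s \<longleftrightarrow> has_signature P s"
proof -
  have "map_poly complex_of_real (smult c P) = smult (of_real c) (map_poly complex_of_real P)"
    by (intro poly_eqI) (simp add: coeff_map_poly)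
  then show ?thesis using assms by (simp add: has_signature_def order_smult Let_def)
qed

section \<open>Polynomials under perturbation of their coefficients\<close>

definition coeff_poly :: "nat \<Rightarrow> (nat \<Rightarrow> real) \<Rightarrow> real poly" where
  "coeff_poly d p = (\<Sum>i\<le>d. monom (p i) i)"

text \<open>Only real \<open>x\<close> is considered, since non-real roots may collide without
  changing the number of real roots. The condition also makes sense when
  \<open>p d = 0\<close>.\<close>

definition double_root :: "nat \<Rightarrow> (nat \<Rightarrow> real) \<Rightarrow> real \<Rightarrow> bool" where
  "double_root d p x \<longleftrightarrow> poly (coeff_poly d p) x = 0 \<and> poly (pderiv (coeff_poly d p)) x = 0"

lemma coeff_coeff_poly: "coeff (coeff_poly d p) i = (if i \<le> d then p i else 0)"
  by (simp add: coeff_poly_def coeff_sum)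

lemma poly_coeff_poly: "poly (coeff_poly d p) x = (\<Sum>i\<le>d. p i * x ^ i)"
  by (simp add: coeff_poly_def poly_sum poly_monom)

lemma poly_pderiv_coeff_poly: "poly (pderiv (coeff_poly d p)) x = (\<Sum>i\<le>d. real i * p i * x ^ (i - 1))"
  using higher_pderiv_sum[of 1 "\<lambda>i. monom (p i) i" "{..d}"]
  by (simp add: coeff_poly_def poly_sum poly_monom pderiv_monom)

lemma degree_coeff_poly: "p d \<noteq> 0 \<Longrightarrow> degree (coeff_poly d p) = d"
  by (intro antisym degree_le le_degree) (auto simp: coeff_coeff_poly)

lemma coeff_poly_nonzero: "p d \<noteq> 0 \<Longrightarrow> coeff_poly d p \<noteq> 0"
  by (metis coeff_0 coeff_coeff_poly order_refl)

lemma coeff_poly_scale: "coeff_poly d (\<lambda>i. c * p i) = smult c (coeff_poly d p)"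
  by (intro poly_eqI) (auto simp: coeff_coeff_poly)

text \<open>If \<open>\<bar>x\<bar> > 1\<close>, the lower terms are at most their coefficients
  times \<open>\<bar>x\<bar> ^ (d - 1)\<close>. The bound is uniform while the leading coefficient
  stays away from 0, so no root escapes to infinity under a small perturbation.\<close>

lemma root_bound:
  assumes "p d \<noteq> 0" "poly (coeff_poly d p) x = 0"
  shows "\<bar>x\<bar> \<le> max 1 ((\<Sum>i\<le>d. \<bar>p i\<bar>) / \<bar>p d\<bar>)"
proof (cases "\<bar>x\<bar> \<le> 1")
  case False
  show ?thesis
  proof (cases d)
    case 0
    then show ?thesis using assms by (simp add: poly_coeff_poly)
  next
    case (Suc n)
    have "p d * x ^ d = - (\<Sum>i\<le>n. p i * x ^ i)"
      using assms(2) Suc by (simp add: poly_coeff_poly)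
    then have "\<bar>p d\<bar> * \<bar>x\<bar> ^ d = \<bar>\<Sum>i\<le>n. p i * x ^ i\<bar>"
      by (metis abs_minus_cancel abs_mult power_abs)
    also have "\<dots> \<le> (\<Sum>i\<le>n. \<bar>p i\<bar> * \<bar>x\<bar> ^ i)"
      by (rule order.trans[OF sum_abs]) (simp add: abs_mult power_abs)
    also have "\<dots> \<le> (\<Sum>i\<le>n. \<bar>p i\<bar> * \<bar>x\<bar> ^ n)"
      using False by (intro sum_mono mult_left_mono power_increasing) auto
    also have "\<dots> = (\<Sum>i\<le>n. \<bar>p i\<bar>) * \<bar>x\<bar> ^ n" by (simp add: sum_distrib_right)
    finally have "(\<bar>p d\<bar> * \<bar>x\<bar>) * \<bar>x\<bar> ^ n \<le> (\<Sum>i\<le>n. \<bar>p i\<bar>) * \<bar>x\<bar> ^ n"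
      by (simp add: Suc mult_ac)
    then have "\<bar>p d\<bar> * \<bar>x\<bar> \<le> (\<Sum>i\<le>n. \<bar>p i\<bar>)"
      using False by (subst (asm) mult_le_cancel_right) auto
    also have "\<dots> \<le> (\<Sum>i\<le>d. \<bar>p i\<bar>)" by (simp add: Suc)
    finally have "\<bar>x\<bar> \<le> (\<Sum>i\<le>d. \<bar>p i\<bar>) / \<bar>p d\<bar>"
      using assms(1) by (simp add: field_simps)
    then show ?thesis by simp
  qed
qed simp

text \<open>The weight \<open>real i + 1\<close> dominates both the factor 1 of a monomial and the
  factor \<open>i\<close> of its derivative, so one constant serves both estimates.\<close>

lemma coeff_poly_close:
  assumes "\<And>i. i \<le> d \<Longrightarrow> \<bar>q i - p i\<bar> \<le> \<delta>" "\<bar>x\<bar> \<le> T" "T \<ge> 1"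
  defines "M \<equiv> (\<Sum>i\<le>d. (real i + 1) * T ^ i)"
  shows "\<bar>poly (coeff_poly d q) x - poly (coeff_poly d p) x\<bar> \<le> \<delta> * M"
    and "\<bar>poly (pderiv (coeff_poly d q)) x - poly (pderiv (coeff_poly d p)) x\<bar> \<le> \<delta> * M"
proof -
  have \<delta>: "\<delta> \<ge> 0" using assms(1)[of 0] by simp
  have "\<bar>poly (coeff_poly d q) x - poly (coeff_poly d p) x\<bar> = \<bar>\<Sum>i\<le>d. (q i - p i) * x ^ i\<bar>"
    by (simp add: poly_coeff_poly sum_subtractf algebra_simps)
  also have "\<dots> \<le> (\<Sum>i\<le>d. \<bar>q i - p i\<bar> * \<bar>x\<bar> ^ i)"
    by (rule order.trans[OF sum_abs]) (simp add: abs_mult power_abs)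
  also have "\<dots> \<le> (\<Sum>i\<le>d. \<delta> * ((real i + 1) * T ^ i))"
  proof (intro sum_mono mult_mono)
    fix i assume "i \<in> {..d}"
    have "\<bar>x\<bar> ^ i \<le> T ^ i" using assms by (intro power_mono) auto
    also have "\<dots> \<le> (real i + 1) * T ^ i" using assms by (simp add: algebra_simps)
    finally show "\<bar>x\<bar> ^ i \<le> (real i + 1) * T ^ i" .
  qed (use assms \<delta> in auto)
  finally show "\<bar>poly (coeff_poly d q) x - poly (coeff_poly d p) x\<bar> \<le> \<delta> * M"
    by (simp add: M_def sum_distrib_left)
  have "\<bar>poly (pderiv (coeff_poly d q)) x - poly (pderiv (coeff_poly d p)) x\<bar>
     = \<bar>\<Sum>i\<le>d. (q i - p i) * (real i * x ^ (i - 1))\<bar>"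
    by (simp add: poly_pderiv_coeff_poly sum_subtractf algebra_simps)
  also have "\<dots> \<le> (\<Sum>i\<le>d. \<bar>q i - p i\<bar> * (real i * \<bar>x\<bar> ^ (i - 1)))"
    by (rule order.trans[OF sum_abs]) (simp add: abs_mult power_abs)
  also have "\<dots> \<le> (\<Sum>i\<le>d. \<delta> * ((real i + 1) * T ^ i))"
  proof (intro sum_mono mult_mono)
    fix i assume "i \<in> {..d}"
    have "\<bar>x\<bar> ^ (i - 1) \<le> T ^ (i - 1)" using assms by (intro power_mono) auto
    also have "\<dots> \<le> T ^ i" using assms by (intro power_increasing) auto
    finally show "\<bar>x\<bar> ^ (i - 1) \<le> T ^ i" .
  qed (use assms \<delta> in auto)
  finally show "\<bar>poly (pderiv (coeff_poly d q)) x - poly (pderiv (coeff_poly d p)) x\<bar> \<le> \<delta> * M"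
    by (simp add: M_def sum_distrib_left)
qed

lemma card_real_roots_stable:
  assumes pd: "p d \<noteq> 0" and simple: "\<And>x. \<not> double_root d p x"
  obtains \<delta> where "\<delta> > 0"
    "\<And>q. (\<And>i. i \<le> d \<Longrightarrow> \<bar>q i - p i\<bar> < \<delta>) \<Longrightarrow> q d \<noteq> 0 \<and> (\<forall>x. \<not> double_root d q x) \<and>
       card {x. poly (coeff_poly d q) x = 0} = card {x. poly (coeff_poly d p) x = 0}"
proof -
  \<comment> \<open>Letting each coefficient grow by 1 and the leading one halve makes
    \<open>R\<close> a bound for the roots of every \<open>q\<close> within \<open>\<delta>0\<close>
    of \<open>p\<close>.\<close>
  define R where "R = max 1 ((\<Sum>i\<le>d. \<bar>p i\<bar> + 1) / (\<bar>p d\<bar> / 2))"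
  define M where "M = (\<Sum>i\<le>d. (real i + 1) * (R + 1) ^ i)"
  have R: "R \<ge> 1" by (simp add: R_def)
  have M: "M > 0" unfolding M_def using R by (intro sum_pos) auto
  define \<delta>0 where "\<delta>0 = min 1 (\<bar>p d\<bar> / 2)"
  have qd: "\<bar>q d\<bar> \<ge> \<bar>p d\<bar> / 2 \<and> q d \<noteq> 0" if "\<And>i. i \<le> d \<Longrightarrow> \<bar>q i - p i\<bar> < \<delta>0" for q
    using that[of d] pd unfolding \<delta>0_def by (auto simp: abs_if split: if_splits)
  have bound: "\<bar>x\<bar> \<le> R" if q: "\<And>i. i \<le> d \<Longrightarrow> \<bar>q i - p i\<bar> < \<delta>0" and x: "poly (coeff_poly d q) x = 0" for q x
  proof -
    have "\<bar>x\<bar> \<le> max 1 ((\<Sum>i\<le>d. \<bar>q i\<bar>) / \<bar>q d\<bar>)" using root_bound x qd[OF q] by blast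
    also have "\<dots> \<le> R" unfolding R_def
    proof (intro max.mono order_refl frac_le sum_mono sum_nonneg)
      show "\<bar>q i\<bar> \<le> \<bar>p i\<bar> + 1" if "i \<in> {..d}" for i
        using q[of i] that by (auto simp: \<delta>0_def)
    qed (use qd[OF q] pd in auto)
    finally show ?thesis .
  qed
  let ?f = "\<lambda>q x. poly (coeff_poly d q) x" and ?f' = "\<lambda>q x. poly (pderiv (coeff_poly d q)) x"
  obtain e where e: "e > 0"
    and e1: "\<And>x g g'. \<lbrakk>x \<in> {- R - 1..R + 1}; \<bar>g x - ?f p x\<bar> < e; \<bar>g' x - ?f' p x\<bar> < e\<rbrakk> \<Longrightarrow> g x \<noteq> 0 \<or> g' x \<noteq> 0"
    and e2: "\<And>g g' h h'. \<lbrakk>\<And>x. (g has_real_derivative g' x) (at x); \<And>x. (h has_real_derivative h' x) (at x);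
       continuous_on UNIV h';
       \<And>x. x \<in> {- R - 1..R + 1} \<Longrightarrow> \<bar>g x - ?f p x\<bar> < e \<and> \<bar>g' x - ?f' p x\<bar> < e \<and> \<bar>h x - ?f p x\<bar> < e \<and> \<bar>h' x - ?f' p x\<bar> < e;
       \<And>x. g x = 0 \<Longrightarrow> \<bar>x\<bar> \<le> R; finite {x. h x = 0}\<rbrakk>
       \<Longrightarrow> card {x. g x = 0} \<le> card {x. h x = 0}"
  proof (rule card_zeros_le_if_C1_close[of "?f p" "?f' p" R])
    show "?f p x \<noteq> 0 \<or> ?f' p x \<noteq> 0" for x using simple[of x] by (auto simp: double_root_def)
  qed (use R in \<open>auto intro: poly_DERIV continuous_intros\<close>)
  define \<delta> where "\<delta> = min \<delta>0 (e / (2 * M))"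
  have \<delta>: "\<delta> > 0" "\<delta> \<le> \<delta>0" "\<delta> * M \<le> e / 2"
    using e M pd by (auto simp: \<delta>_def \<delta>0_def min_def field_simps)
  show thesis
  proof (rule that[OF \<delta>(1)])
    fix q assume q: "\<And>i. i \<le> d \<Longrightarrow> \<bar>q i - p i\<bar> < \<delta>"
    have q0: "\<And>i. i \<le> d \<Longrightarrow> \<bar>q i - p i\<bar> < \<delta>0" using q \<delta>(2) by force
    have p0: "\<And>i. i \<le> d \<Longrightarrow> \<bar>p i - p i\<bar> < \<delta>0" using pd by (simp add: \<delta>0_def)
    have cl: "\<bar>?f q x - ?f p x\<bar> < e \<and> \<bar>?f' q x - ?f' p x\<bar> < e" if "x \<in> {- R - 1..R + 1}" for x
      using coeff_poly_close[of d q p \<delta> x "R + 1"] q that R \<delta>(3) e by (force simp: M_def)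
    have "\<not> double_root d q x" for x
    proof
      assume dr: "double_root d q x"
      then have "\<bar>x\<bar> \<le> R" using bound[OF q0] by (auto simp: double_root_def)
      then have "x \<in> {- R - 1..R + 1}" by auto
      then show False using e1[of x "?f q" "?f' q"] cl dr by (auto simp: double_root_def)
    qed
    \<comment> \<open>The comparison of zeros is used twice, with the roles of \<open>p\<close> and
      \<open>q\<close> exchanged.\<close>
    moreover have "card {x. ?f q x = 0} \<le> card {x. ?f p x = 0}"
      by (rule e2) (use cl e bound[OF q0] coeff_poly_nonzero pd in
          \<open>auto intro: poly_DERIV continuous_intros poly_roots_finite\<close>)
    moreover have "card {x. ?f p x = 0} \<le> card {x. ?f q x = 0}"
      by (rule e2) (use cl e bound[OF p0] qd[OF q0] coeff_poly_nonzero in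
          \<open>auto intro: poly_DERIV continuous_intros poly_roots_finite\<close>)
    ultimately show "q d \<noteq> 0 \<and> (\<forall>x. \<not> double_root d q x) \<and>
       card {x. poly (coeff_poly d q) x = 0} = card {x. poly (coeff_poly d p) x = 0}"
      using qd[OF q0] by auto
  qed
qed

lemma has_signature_coeff_poly_iff:
  assumes "p d \<noteq> 0" "\<And>x. \<not> double_root d p x"
  shows "has_signature (coeff_poly d p) s \<longleftrightarrow> card {x. poly (coeff_poly d p) x = 0} + 2 * s = d"
  using has_signature_iff_card_real_roots[OF coeff_poly_nonzero, of p d s] assms degree_coeff_poly[of p d]
  by (auto simp: double_root_def)

text \<open>Along the segment the number of real roots is locally constant, hence constant because
  \<open>{0..1}\<close> is connected; without real double roots it determines the signature.\<close>

lemma signature_const_on_segment: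
  assumes seg: "\<And>t. t \<in> {0..1} \<Longrightarrow> (1 - t) * p d + t * q d \<noteq> 0"
    and simple: "\<And>t x. t \<in> {0..1} \<Longrightarrow> \<not> double_root d (\<lambda>i. (1 - t) * p i + t * q i) x"
  shows "has_signature (coeff_poly d p) s \<longleftrightarrow> has_signature (coeff_poly d q) s"
proof -
  define r where "r t i = (1 - t) * p i + t * q i" for t i
  define N where "N t = card {x. poly (coeff_poly d (r t)) x = 0}" for t
  have "N 0 = N 1"
  proof (rule connected_local_const[of "{0..1::real}"])
    show "\<forall>a\<in>{0..1}. \<forall>\<^sub>F b in at a within {0..1}. N a = N b"
    proof
      fix a :: real assume a: "a \<in> {0..1}"
      obtain \<delta> where \<delta>: "\<delta> > 0" "\<And>w. (\<And>i. i \<le> d \<Longrightarrow> \<bar>w i - r a i\<bar> < \<delta>) \<Longrightarrow>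
          card {x. poly (coeff_poly d w) x = 0} = card {x. poly (coeff_poly d (r a)) x = 0}"
        proof (rule card_real_roots_stable[of "r a" d])
        show "r a d \<noteq> 0" using seg[OF a] by (simp add: r_def)
        show "\<not> double_root d (r a) x" for x using simple[OF a] by (simp add: r_def[abs_def])
      qed blast
      have "\<forall>\<^sub>F b in at a within {0..1}. \<forall>i\<in>{..d}. \<bar>r b i - r a i\<bar> < \<delta>"
      proof (rule eventually_ball_finite)
        show "\<forall>i\<in>{..d}. \<forall>\<^sub>F b in at a within {0..1}. \<bar>r b i - r a i\<bar> < \<delta>"
        proof
          fix i
          have "((\<lambda>b. r b i) \<longlongrightarrow> r a i) (at a within {0..1})"
            unfolding r_def by (intro tendsto_intros)
          then show "\<forall>\<^sub>F b in at a within {0..1}. \<bar>r b i - r a i\<bar> < \<delta>"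
            using \<delta>(1) by (auto simp: tendsto_iff dist_real_def)
        qed
      qed auto
      then show "\<forall>\<^sub>F b in at a within {0..1}. N a = N b"
        by eventually_elim (use \<delta>(2) in \<open>auto simp: N_def\<close>)
    qed
  qed auto
  moreover have "has_signature (coeff_poly d (r t)) s \<longleftrightarrow> N t + 2 * s = d" if "t \<in> {0..1}" for t
    using has_signature_coeff_poly_iff[of "r t" d s] seg[OF that] simple[OF that]
    by (simp add: N_def r_def[abs_def])
  moreover have "r 0 = p" "r 1 = q" by (auto simp: r_def)
  ultimately show ?thesis by (metis atLeastAtMost_iff order_refl zero_le_one)
qed

section \<open>Cubes meeting the boundary\<close>

definition cube :: "nat \<Rightarrow> real \<Rightarrow> (nat \<Rightarrow> int) \<Rightarrow> (nat \<Rightarrow> real) set" where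
  "cube d B a = {p. \<forall>i\<le>d. \<lfloor>B * p i\<rfloor> = a i}"

text \<open>These are the values of \<open>\<lfloor>B * t\<rfloor>\<close> for
  \<open>\<bar>t\<bar> \<le> 1\<close>. The top value is included because the cubes are half-open
  and \<open>t = 1\<close> must be covered.\<close>

definition side :: "real \<Rightarrow> int set" where
  "side B = {\<lfloor>- B\<rfloor>..\<lfloor>B\<rfloor>}"

definition grid :: "nat \<Rightarrow> real \<Rightarrow> (nat \<Rightarrow> int) set" where
  "grid d B = PiE {..d} (\<lambda>_. side B)"

text \<open>Like \<open>cube\<close>, it ignores the entries beyond \<open>d\<close>, so that
  segments, reversals and corners need not be made extensional; \<open>ext_cube\<close> and
  \<open>H_set\<close> restore extensionality for the measure.\<close>

definition coeff_region :: "nat \<Rightarrow> nat \<Rightarrow> (nat \<Rightarrow> real) set" where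
  "coeff_region d s = {p. p d \<noteq> 0 \<and> (\<forall>i\<le>d. \<bar>p i\<bar> \<le> 1) \<and> has_signature (coeff_poly d p) s}"

definition boundary_grid :: "nat \<Rightarrow> nat \<Rightarrow> real \<Rightarrow> (nat \<Rightarrow> int) set" where
  "boundary_grid d s B = {a \<in> grid d B. cube d B a \<inter> coeff_region d s \<noteq> {} \<and> \<not> cube d B a \<subseteq> coeff_region d s}"

definition double_root_grid :: "nat \<Rightarrow> real \<Rightarrow> (nat \<Rightarrow> int) set" where
  "double_root_grid d B = {a \<in> grid d B. \<exists>p\<in>cube d B a. \<exists>x. \<bar>x\<bar> \<le> 1 \<and> double_root d p x}"

lemma finite_side [simp]: "finite (side B)"
  by (simp add: side_def)

lemma finite_grid [simp]: "finite (grid d B)"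
  unfolding grid_def by (intro finite_PiE) auto

lemma card_side_le:
  assumes "B \<ge> 1"
  shows "real (card (side B)) \<le> 4 * B"
proof -
  have "real (card (side B)) = of_int (\<lfloor>B\<rfloor> - \<lfloor>- B\<rfloor> + 1)"
    using assms by (simp add: side_def floor_mono)
  also have "\<dots> \<le> 4 * B" using assms by linarith
  finally show ?thesis .
qed

lemma side_abs_le:
  assumes "B \<ge> 1" "k \<in> side B"
  shows "\<bar>real_of_int k\<bar> \<le> 2 * B"
  using assms by (auto simp: side_def) linarith

section \<open>Cubes containing a polynomial with a double root in [-1, 1]\<close>

lemma power_diff_le:
  fixes x y :: real
  assumes "\<bar>x\<bar> \<le> 2" "\<bar>y\<bar> \<le> 2"
  shows "\<bar>x ^ n - y ^ n\<bar> \<le> real n * 2 ^ n * \<bar>x - y\<bar>"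
proof (induction n)
  case (Suc n)
  have "\<bar>x ^ Suc n - y ^ Suc n\<bar> = \<bar>x * (x ^ n - y ^ n) + (x - y) * y ^ n\<bar>"
    by (simp add: algebra_simps)
  also have "\<dots> \<le> \<bar>x\<bar> * \<bar>x ^ n - y ^ n\<bar> + \<bar>x - y\<bar> * \<bar>y\<bar> ^ n"
    by (rule order.trans[OF abs_triangle_ineq]) (simp add: abs_mult power_abs)
  also have "\<dots> \<le> 2 * (real n * 2 ^ n * \<bar>x - y\<bar>) + \<bar>x - y\<bar> * 2 ^ n"
    using assms Suc by (intro add_mono mult_mono power_mono) auto
  also have "\<dots> \<le> real (Suc n) * 2 ^ Suc n * \<bar>x - y\<bar>"
    by (simp add: algebra_simps)
  finally show ?case .
qed simp

text \<open>The coefficient \<open>a\<close> has size \<open>B\<close>, but \<open>x\<close> is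
  known up to \<open>1 / B\<close>, so the error does not grow with \<open>B\<close>.\<close>

lemma term_error:
  fixes q a x y B :: real
  assumes "B \<ge> 1" "\<bar>q - a\<bar> \<le> 1" "\<bar>a\<bar> \<le> 2 * B" "\<bar>x\<bar> \<le> 1" "\<bar>x - y\<bar> \<le> 1 / B" "n \<le> d"
  shows "\<bar>q * x ^ n - a * y ^ n\<bar> \<le> 1 + 2 * real d * 2 ^ d"
proof -
  have "1 / B \<le> 1" using assms(1) by simp
  then have y: "\<bar>y\<bar> \<le> 2" using assms(4,5) by linarith
  have "\<bar>q * x ^ n - a * y ^ n\<bar> = \<bar>(q - a) * x ^ n + a * (x ^ n - y ^ n)\<bar>"
    by (simp add: algebra_simps)
  also have "\<dots> \<le> \<bar>q - a\<bar> * \<bar>x\<bar> ^ n + \<bar>a\<bar> * \<bar>x ^ n - y ^ n\<bar>"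
    by (rule order.trans[OF abs_triangle_ineq]) (simp add: abs_mult power_abs)
  also have "\<dots> \<le> 1 * 1 + (2 * B) * (real n * 2 ^ n * (1 / B))"
  proof (intro add_mono mult_mono assms)
    have "\<bar>x ^ n - y ^ n\<bar> \<le> real n * 2 ^ n * \<bar>x - y\<bar>"
      using assms(4) y by (intro power_diff_le) auto
    also have "\<dots> \<le> real n * 2 ^ n * (1 / B)"
      using assms(5) by (intro mult_left_mono) auto
    finally show "\<bar>x ^ n - y ^ n\<bar> \<le> real n * 2 ^ n * (1 / B)" .
  qed (use assms in \<open>auto intro: power_le_one\<close>)
  also have "\<dots> = 1 + 2 * (real n * 2 ^ n)" using assms(1) by simp
  also have "\<dots> \<le> 1 + 2 * (real d * 2 ^ d)"
    using assms(6) by (intro add_left_mono mult_left_mono mult_mono power_increasing) auto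
  finally show ?thesis by simp
qed

text \<open>Weights \<open>c\<close> and exponents \<open>n\<close> are left free so that one
  estimate covers both the weights \<open>i\<close> with exponents \<open>i - 1\<close> and the
  weights \<open>i - 1\<close> with exponents \<open>i\<close>.\<close>

lemma sum_error:
  fixes q c :: "nat \<Rightarrow> real" and a :: "nat \<Rightarrow> int"
  assumes "B \<ge> 1" "\<bar>x\<bar> \<le> 1" "\<bar>x - y\<bar> \<le> 1 / B"
    and "\<And>i. i \<in> {2..d} \<Longrightarrow> \<bar>q i - a i\<bar> \<le> 1 \<and> \<bar>real_of_int (a i)\<bar> \<le> 2 * B \<and> \<bar>c i\<bar> \<le> d \<and> n i \<le> d"
  shows "\<bar>(\<Sum>i=2..d. c i * q i * x ^ n i) - (\<Sum>i=2..d. c i * a i * y ^ n i)\<bar>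
    \<le> real d * (real d * (1 + 2 * real d * 2 ^ d))"
proof -
  have "\<bar>(\<Sum>i=2..d. c i * q i * x ^ n i) - (\<Sum>i=2..d. c i * a i * y ^ n i)\<bar>
      = \<bar>\<Sum>i=2..d. c i * (q i * x ^ n i - a i * y ^ n i)\<bar>"
    by (simp add: sum_subtractf algebra_simps)
  also have "\<dots> \<le> (\<Sum>i=2..d. \<bar>c i\<bar> * \<bar>q i * x ^ n i - a i * y ^ n i\<bar>)"
    by (rule order.trans[OF sum_abs]) (simp add: abs_mult)
  also have "\<dots> \<le> (\<Sum>i=2..d. real d * (1 + 2 * real d * 2 ^ d))"
    using assms by (intro sum_mono mult_mono term_error) auto
  also have "\<dots> = real (d - 1) * (real d * (1 + 2 * real d * 2 ^ d))"
    by (simp add: of_nat_diff numeral_2_eq_2)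
  also have "\<dots> \<le> real d * (real d * (1 + 2 * real d * 2 ^ d))"
    by (intro mult_right_mono) auto
  finally show ?thesis .
qed

lemma floor_diff_le:
  fixes u v K :: real
  assumes "\<bar>u - v\<bar> \<le> K"
  shows "\<lfloor>u\<rfloor> - \<lfloor>v\<rfloor> \<in> {- (\<lceil>K\<rceil> + 1)..\<lceil>K\<rceil> + 1}"
  using assms by auto linarith+

text \<open>If \<open>x\<close> is a double root of \<open>p\<close>, then \<open>p 1\<close> and \<open>p 0\<close> are smooth functions of \<open>x\<close> and the
  higher coefficients, so that up to boundedly many choices the cube of \<open>p\<close> is determined by
  \<open>\<lfloor>B * x\<rfloor>\<close> and its higher coordinates.\<close>

lemma double_root_grid_bound:
  assumes "d \<ge> 1"
  obtains C :: real where "C \<ge> 0" "\<And>B. B \<ge> 1 \<Longrightarrow> real (card (double_root_grid d B)) \<le> C * B ^ d"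
proof -
  \<comment> \<open>The ceiling bounds the error from \<open>sum_error\<close>; the additional 1
    pays for taking floors on both sides.\<close>
  define K where "K = \<lceil>real d * (real d * (1 + 2 * real d * 2 ^ d))\<rceil> + 1"
  define E where "E = {- K..K}"
  have "real (card (double_root_grid d B)) \<le> (card E * card E * 4 ^ d) * B ^ d" if B: "B \<ge> 1" for B :: real
  proof -
    \<comment> \<open>Solving P'(x) = 0 for \<open>B * p 1\<close> and then P(x) = 0 for
      \<open>B * p 0\<close> gives these sums, here evaluated at rounded data: \<open>b i\<close>
      for \<open>B * p i\<close> and \<open>k / B\<close> for \<open>x\<close>.\<close>
    define \<psi>1 where "\<psi>1 b k = - (\<Sum>i=2..d. real i * b i * (k / B) ^ (i - 1))" for b :: "nat \<Rightarrow> int" and k :: int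
    define \<psi>0 where "\<psi>0 b k = (\<Sum>i=2..d. (real i - 1) * b i * (k / B) ^ i)" for b :: "nat \<Rightarrow> int" and k :: int
    define \<Phi> where "\<Phi> = (\<lambda>(b, k, e1, e0). \<lambda>i\<in>{..d}. if i = 0 then \<lfloor>\<psi>0 b k\<rfloor> + e0
       else if i = 1 then \<lfloor>\<psi>1 b k\<rfloor> + e1 else b i)"
    \<comment> \<open>Besides two bounded corrections from \<open>E\<close>, there are
      \<open>d - 1\<close> coordinates of \<open>b\<close> and one \<open>k\<close>, hence
      \<open>d\<close> free choices from \<open>side B\<close>.\<close>
    define S where "S = PiE {2..d} (\<lambda>_. side B) \<times> side B \<times> E \<times> E"
    have finS: "finite S" unfolding S_def E_def by (intro finite_cartesian_product finite_PiE) auto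
    have "double_root_grid d B \<subseteq> \<Phi> ` S"
    proof
      fix a assume "a \<in> double_root_grid d B"
      then obtain p x where a: "a \<in> grid d B" and p: "p \<in> cube d B a" and x: "\<bar>x\<bar> \<le> 1"
        and dr: "double_root d p x"
        by (auto simp: double_root_grid_def)
      define q where "q i = B * p i" for i
      define k where "k = \<lfloor>B * x\<rfloor>"
      have fl: "\<lfloor>q i\<rfloor> = a i" if "i \<le> d" for i using p that by (auto simp: cube_def q_def)
      have aside: "a i \<in> side B" if "i \<le> d" for i using a that by (auto simp: grid_def)
      have kside: "k \<in> side B"
      proof -
        have "B * x \<le> B" "- B \<le> B * x"
          using x B mult_left_mono[of x 1 B] mult_left_mono[of "-1" x B] by auto
        then show ?thesis by (auto simp: k_def side_def intro: floor_mono)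
      qed
      have xk: "\<bar>x - k / B\<bar> \<le> 1 / B"
      proof -
        have "\<bar>B * x - k\<bar> \<le> 1" unfolding k_def by linarith
        then have "\<bar>B * x - k\<bar> / B \<le> 1 / B" using B by (intro divide_right_mono) auto
        also have "\<bar>B * x - k\<bar> / B = \<bar>(B * x - k) / B\<bar>" using B by simp
        also have "(B * x - k) / B = x - k / B" using B by (simp add: field_simps)
        finally show ?thesis .
      qed
      define a' where "a' = restrict a {2..d}"
      have split: "{..d} = insert 0 (insert 1 {2..d})" using assms by auto
      have P': "q 1 + (\<Sum>i=2..d. real i * q i * x ^ (i - 1)) = 0"
        using dr unfolding double_root_def poly_pderiv_coeff_poly split
        by (auto simp: q_def sum_distrib_left algebra_simps dest: arg_cong[of _ _ "\<lambda>t. B * t"])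
      have P: "q 0 + q 1 * x + (\<Sum>i=2..d. q i * x ^ i) = 0"
        using dr unfolding double_root_def poly_coeff_poly split
        by (auto simp: q_def sum_distrib_left algebra_simps dest: arg_cong[of _ _ "\<lambda>t. B * t"])
      have q1: "q 1 = - (\<Sum>i=2..d. real i * q i * x ^ (i - 1))" using P' by linarith
      \<comment> \<open>Inserting \<open>q1\<close> into \<open>P\<close> combines the weights
        \<open>i\<close> and 1 into \<open>i - 1\<close>.\<close>
      have "q 1 * x = - (\<Sum>i=2..d. real i * q i * (x ^ (i - 1) * x))"
        by (subst q1) (simp add: sum_distrib_left mult_ac)
      also have "(\<Sum>i=2..d. real i * q i * (x ^ (i - 1) * x)) = (\<Sum>i=2..d. real i * q i * x ^ i)"
      proof (intro sum.cong refl)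
        fix i assume "i \<in> {2..d}"
        then have "x ^ (i - 1) * x = x ^ i" by (intro power_minus_mult) simp
        then show "real i * q i * (x ^ (i - 1) * x) = real i * q i * x ^ i" by (simp only:)
      qed
      finally have q0: "q 0 = (\<Sum>i=2..d. (real i - 1) * q i * x ^ i)"
        using P by (simp add: algebra_simps sum_subtractf)
      have cond: "\<bar>q i - a' i\<bar> \<le> 1 \<and> \<bar>real_of_int (a' i)\<bar> \<le> 2 * B" if "i \<in> {2..d}" for i
        using fl[of i] that side_abs_le[OF B aside, of i] by (auto simp: a'_def) linarith
      have "\<bar>q 1 - \<psi>1 a' k\<bar> = \<bar>(\<Sum>i=2..d. real i * q i * x ^ (i - 1)) - (\<Sum>i=2..d. real i * a' i * (k / B) ^ (i - 1))\<bar>"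
        unfolding \<psi>1_def q1 by simp
      also have "\<dots> \<le> real d * (real d * (1 + 2 * real d * 2 ^ d))"
        using cond by (intro sum_error[OF B x xk]) auto
      finally have e1: "a 1 - \<lfloor>\<psi>1 a' k\<rfloor> \<in> E"
        using floor_diff_le[of "q 1" "\<psi>1 a' k"] fl[of 1] assms unfolding E_def K_def by metis
      have "\<bar>q 0 - \<psi>0 a' k\<bar> \<le> real d * (real d * (1 + 2 * real d * 2 ^ d))"
        unfolding \<psi>0_def q0 using cond by (intro sum_error[OF B x xk]) auto
      then have e0: "a 0 - \<lfloor>\<psi>0 a' k\<rfloor> \<in> E"
        using floor_diff_le[of "q 0" "\<psi>0 a' k"] fl[of 0] assms unfolding E_def K_def by (metis le0)
      have "a = \<Phi> (a', k, a 1 - \<lfloor>\<psi>1 a' k\<rfloor>, a 0 - \<lfloor>\<psi>0 a' k\<rfloor>)"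
      proof
        fix i
        show "a i = \<Phi> (a', k, a 1 - \<lfloor>\<psi>1 a' k\<rfloor>, a 0 - \<lfloor>\<psi>0 a' k\<rfloor>) i"
          using a by (cases "i \<le> d") (auto simp: \<Phi>_def a'_def grid_def PiE_def extensional_def)
      qed
      moreover have "(a', k, a 1 - \<lfloor>\<psi>1 a' k\<rfloor>, a 0 - \<lfloor>\<psi>0 a' k\<rfloor>) \<in> S"
        using kside e1 e0 aside by (auto simp: S_def a'_def)
      ultimately show "a \<in> \<Phi> ` S" by blast
    qed
    then have "card (double_root_grid d B) \<le> card S"
      using finS by (rule surj_card_le[rotated])
    also have "\<dots> = card (side B) ^ (d - 1) * (card (side B) * (card E * card E))"
      by (simp add: S_def card_cartesian_product card_PiE numeral_2_eq_2)
    also have "\<dots> = card (side B) ^ d * (card E * card E)"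
      using assms by (simp add: mult_ac power_minus_mult flip: power_Suc)
    finally have "real (card (double_root_grid d B)) \<le> real (card (side B)) ^ d * (card E * card E)"
      by (metis of_nat_le_iff of_nat_mult of_nat_power)
    also have "\<dots> \<le> (4 * B) ^ d * (card E * card E)"
      using card_side_le[OF B] by (intro mult_right_mono power_mono) auto
    finally show ?thesis by (simp add: power_mult_distrib mult_ac)
  qed
  then show thesis by (intro that[of "card E * card E * 4 ^ d"]) auto
qed

section \<open>Double roots outside [-1, 1] by reversal of coefficients\<close>

text \<open>With R the reversal of P in formal degree d, R(1/x) = x^(-d) P(x) and R'(1/x) = x^(1-d)
  (d P(x) - x P'(x)). Both identities hold even if the leading coefficient is 0.\<close>

lemma double_root_reverse:
  assumes "double_root d p x" "x \<noteq> 0"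
  shows "double_root d (\<lambda>i. p (d - i)) (1 / x)"
proof -
  have P: "(\<Sum>i\<le>d. p i * x ^ i) = 0" and P': "(\<Sum>i\<le>d. real i * p i * x ^ (i - 1)) = 0"
    using assms by (simp_all add: double_root_def poly_coeff_poly poly_pderiv_coeff_poly)
  have "(\<Sum>i\<le>d. real i * p i * x ^ i) = x * (\<Sum>i\<le>d. real i * p i * x ^ (i - 1))"
    unfolding sum_distrib_left
  proof (intro sum.cong refl)
    fix i show "real i * p i * x ^ i = x * (real i * p i * x ^ (i - 1))" by (cases i) auto
  qed
  then have xP': "(\<Sum>i\<le>d. real i * p i * x ^ i) = 0" using P' by simp
  have "(\<Sum>i\<le>d. p (d - i) * (1 / x) ^ i) = (\<Sum>i\<le>d. p i * (1 / x) ^ (d - i))"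
    by (rule sum.reindex_bij_witness[of _ "\<lambda>i. d - i" "\<lambda>i. d - i"]) auto
  also have "\<dots> = (1 / x) ^ d * (\<Sum>i\<le>d. p i * x ^ i)"
    unfolding sum_distrib_left
    using assms(2) by (intro sum.cong refl) (auto simp: power_diff power_divide field_simps)
  finally have 1: "(\<Sum>i\<le>d. p (d - i) * (1 / x) ^ i) = 0" using P by simp
  have "(\<Sum>i\<le>d. real i * p (d - i) * (1 / x) ^ (i - 1)) = (\<Sum>i\<le>d. real (d - i) * p i * (1 / x) ^ (d - i - 1))"
    by (rule sum.reindex_bij_witness[of _ "\<lambda>i. d - i" "\<lambda>i. d - i"]) auto
  also have "\<dots> = (\<Sum>i\<le>d. (1 / x) ^ (d - 1) * (real d * (p i * x ^ i) - real i * p i * x ^ i))"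
  proof (intro sum.cong refl)
    fix i assume "i \<in> {..d}"
    show "real (d - i) * p i * (1 / x) ^ (d - i - 1) = (1 / x) ^ (d - 1) * (real d * (p i * x ^ i) - real i * p i * x ^ i)"
    proof (cases "i = d")
      case False
      then obtain j where j: "d = Suc (i + j)" using \<open>i \<in> {..d}\<close> less_imp_Suc_add[of i d] by auto
      have "(1 / x) ^ (i + j) * x ^ i = (1 / x) ^ j"
        using assms(2) by (simp add: power_add power_divide)
      then have "(1 / x) ^ (d - 1) * (real d * (p i * x ^ i) - real i * p i * x ^ i) = (1 / x) ^ j * ((real d - real i) * p i)"
        by (simp add: j algebra_simps)
      then show ?thesis by (simp add: j)
    qed simp
  qed
  also have "\<dots> = (1 / x) ^ (d - 1) * (real d * (\<Sum>i\<le>d. p i * x ^ i) - (\<Sum>i\<le>d. real i * p i * x ^ i))"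
    by (simp add: sum_distrib_left sum_subtractf algebra_simps)
  finally have 2: "(\<Sum>i\<le>d. real i * p (d - i) * (1 / x) ^ (i - 1)) = 0" using P xP' by simp
  from 1 2 show ?thesis by (simp add: double_root_def poly_coeff_poly poly_pderiv_coeff_poly)
qed

text \<open>The restriction keeps the result extensional, so that \<open>reflect d\<close> is an
  involution of the grid.\<close>

definition reflect :: "nat \<Rightarrow> (nat \<Rightarrow> int) \<Rightarrow> nat \<Rightarrow> int" where
  "reflect d a = (\<lambda>i\<in>{..d}. a (d - i))"

lemma reflect_in_grid: "a \<in> grid d B \<Longrightarrow> reflect d a \<in> grid d B"
  by (auto simp: reflect_def grid_def)

lemma reflect_reflect: "a \<in> grid d B \<Longrightarrow> reflect d (reflect d a) = a"
  by (auto simp: reflect_def grid_def PiE_def extensional_def fun_eq_iff)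

text \<open>All coordinates of the grid have the same range, so reversal carries cubes to cubes, and
  it replaces a double root with \<open>\<bar>x\<bar> > 1\<close> by \<open>1 / x\<close>.\<close>

lemma grid_double_root_cases:
  assumes a: "a \<in> grid d B" and p: "p \<in> cube d B a" and dr: "double_root d p x"
  shows "a \<in> double_root_grid d B \<union> reflect d ` double_root_grid d B"
proof (cases "\<bar>x\<bar> \<le> 1")
  case False
  then have "double_root d (\<lambda>i. p (d - i)) (1 / x)" using dr by (intro double_root_reverse) auto
  moreover have "(\<lambda>i. p (d - i)) \<in> cube d B (reflect d a)"
    using p by (auto simp: cube_def reflect_def)
  ultimately have "reflect d a \<in> double_root_grid d B"
    using False reflect_in_grid[OF a] unfolding double_root_grid_def
    by (auto intro!: bexI[of _ "\<lambda>i. p (d - i)"] exI[of _ "1 / x"])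
  then show ?thesis using reflect_reflect[OF a] by (metis UnI2 imageI)
qed (use assms in \<open>auto simp: double_root_grid_def\<close>)

section \<open>Faces of the box and the count of boundary cubes\<close>

text \<open>A cube crossing \<open>p i = 1\<close> or \<open>p i = - 1\<close> has
  \<open>a i\<close> equal to \<open>\<lfloor>B\<rfloor>\<close> or
  \<open>\<lfloor>- B\<rfloor>\<close>, and a cube containing a point with \<open>p d = 0\<close>
  has \<open>a d = 0\<close>.\<close>

definition face_grid :: "nat \<Rightarrow> real \<Rightarrow> (nat \<Rightarrow> int) set" where
  "face_grid d B = {a \<in> grid d B. \<exists>i\<le>d. a i \<in> {\<lfloor>B\<rfloor>, \<lfloor>- B\<rfloor>, 0}}"

lemma face_grid_bound:
  assumes B: "B \<ge> 1"
  shows "real (card (face_grid d B)) \<le> (real (d + 1) * 3 * 4 ^ d) * B ^ d"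
proof -
  let ?F = "{\<lfloor>B\<rfloor>, \<lfloor>- B\<rfloor>, 0}"
  let ?G = "\<lambda>i. PiE {..d} (\<lambda>j. if j = i then ?F else side B)"
  have fin: "finite (?G i)" for i by (intro finite_PiE) auto
  have "face_grid d B \<subseteq> (\<Union>i\<le>d. ?G i)"
    by (auto simp: face_grid_def grid_def PiE_iff)
  then have "card (face_grid d B) \<le> card (\<Union>i\<le>d. ?G i)" using fin by (intro card_mono) auto
  also have "\<dots> \<le> (\<Sum>i\<le>d. card (?G i))" by (intro card_UN_le) auto
  also have "\<dots> \<le> (\<Sum>i\<le>d. 3 * card (side B) ^ d)"
  proof (rule sum_mono)
    fix i assume i: "i \<in> {..d}"
    have "card (?G i) = (\<Prod>j\<le>d. if j = i then card ?F else card (side B))"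
      by (subst card_PiE) (auto intro!: prod.cong)
    also have "\<dots> = card ?F * (\<Prod>j\<in>{..d} - {i}. card (side B))"
      using i by (subst prod.remove[of _ i]) auto
    also have "\<dots> = card ?F * card (side B) ^ d" using i by simp
    also have "\<dots> \<le> 3 * card (side B) ^ d"
      by (intro mult_right_mono) (simp_all add: card_insert_if)
    finally show "card (?G i) \<le> 3 * card (side B) ^ d" .
  qed
  also have "\<dots> = (d + 1) * (3 * card (side B) ^ d)" by simp
  finally have "real (card (face_grid d B)) \<le> real ((d + 1) * (3 * card (side B) ^ d))"
    by (simp only: of_nat_le_iff)
  also have "\<dots> = real (d + 1) * (3 * real (card (side B)) ^ d)"
    by (simp only: of_nat_mult of_nat_power of_nat_numeral)
  also have "\<dots> \<le> real (d + 1) * (3 * (4 * B) ^ d)"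
    using card_side_le[OF B] by (intro mult_left_mono power_mono) auto
  finally show ?thesis by (simp only: power_mult_distrib mult_ac)
qed

text \<open>Join a point \<open>p\<close> of the region to a point \<open>q\<close> outside it
  within the same cube. Off the faces, \<open>q\<close> is still in the box and the leading
  coefficient never vanishes on the segment; if there is no double root either, the signature is
  constant and \<open>q\<close> lies in the region after all.\<close>

lemma boundary_grid_cases:
  assumes B: "B \<ge> 1" and a: "a \<in> boundary_grid d s B"
  shows "a \<in> face_grid d B \<union> double_root_grid d B \<union> reflect d ` double_root_grid d B"
proof (rule ccontr)
  assume "\<not> ?thesis"
  then have nface: "a \<notin> face_grid d B"
    and ndr: "a \<notin> double_root_grid d B \<union> reflect d ` double_root_grid d B" by auto
  obtain p q where ag: "a \<in> grid d B" and p: "p \<in> cube d B a" "p \<in> coeff_region d s"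
    and q: "q \<in> cube d B a" "q \<notin> coeff_region d s"
    using a by (auto simp: boundary_grid_def)
  have notF: "a i \<noteq> \<lfloor>B\<rfloor>" "a i \<noteq> \<lfloor>- B\<rfloor>" "a i \<noteq> 0" if "i \<le> d" for i
    using nface ag that by (auto simp: face_grid_def)
  have nz: "r d \<noteq> 0" if "r \<in> cube d B a" for r
    using that notF(3)[of d] by (auto simp: cube_def)
  \<comment> \<open>If \<open>q i\<close> were at or beyond a face while \<open>p i\<close> is not
    beyond it, the floor for that face would lie between the equal floors of \<open>B * p i\<close>
    and \<open>B * q i\<close>, and \<open>a i\<close> would be that value.\<close>
  have qbox: "\<bar>q i\<bar> \<le> 1" if i: "i \<le> d" for i
  proof (rule ccontr)
    have fl: "\<lfloor>B * p i\<rfloor> = a i" "\<lfloor>B * q i\<rfloor> = a i" using p q i by (auto simp: cube_def)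
    have pb: "p i \<le> 1" "- 1 \<le> p i" using p i by (auto simp: coeff_region_def abs_le_iff)
    assume "\<not> \<bar>q i\<bar> \<le> 1"
    then consider "1 \<le> q i" | "q i \<le> - 1" by linarith
    then show False
    proof cases
      case 1
      have "B * p i \<le> B" "B \<le> B * q i"
        using B pb 1 mult_left_mono[of "p i" 1 B] mult_left_mono[of 1 "q i" B] by auto
      then have "\<lfloor>B * p i\<rfloor> \<le> \<lfloor>B\<rfloor>" "\<lfloor>B\<rfloor> \<le> \<lfloor>B * q i\<rfloor>" by (auto intro: floor_mono)
      then show False using fl notF(1)[OF i] by simp
    next
      case 2
      have "B * q i \<le> - B" "- B \<le> B * p i"
        using B pb 2 mult_left_mono[of "q i" "-1" B] mult_left_mono[of "-1" "p i" B] by auto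
      then have "\<lfloor>B * q i\<rfloor> \<le> \<lfloor>- B\<rfloor>" "\<lfloor>- B\<rfloor> \<le> \<lfloor>B * p i\<rfloor>" by (auto intro: floor_mono)
      then show False using fl notF(2)[OF i] by simp
    qed
  qed
  have seg: "(\<lambda>i. (1 - t) * p i + t * q i) \<in> cube d B a" if t: "t \<in> {0..1}" for t
    unfolding cube_def
  proof (intro CollectI allI impI)
    fix i assume i: "i \<le> d"
    have fl: "\<lfloor>B * p i\<rfloor> = a i" "\<lfloor>B * q i\<rfloor> = a i" using p q i by (auto simp: cube_def)
    have "B * p i \<in> {a i..<a i + 1}" "B * q i \<in> {a i..<a i + 1}"
      using fl by (auto simp: floor_eq_iff)
    moreover have "convex {real_of_int (a i)..<real_of_int (a i) + 1}" by simp
    ultimately have "(1 - t) *\<^sub>R (B * p i) + t *\<^sub>R (B * q i) \<in> {a i..<a i + 1}"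
      using t by (intro convexD_alt) auto
    then show "\<lfloor>B * ((1 - t) * p i + t * q i)\<rfloor> = a i"
      by (auto simp: floor_eq_iff algebra_simps)
  qed
  have "has_signature (coeff_poly d p) s \<longleftrightarrow> has_signature (coeff_poly d q) s"
  proof (rule signature_const_on_segment)
    show "(1 - t) * p d + t * q d \<noteq> 0" if "t \<in> {0..1}" for t using nz[OF seg[OF that]] .
    show "\<not> double_root d (\<lambda>i. (1 - t) * p i + t * q i) x" if "t \<in> {0..1}" for t x
      using grid_double_root_cases[OF ag seg[OF that]] ndr by blast
  qed
  then show False using p q qbox nz[OF q(1)] by (auto simp: coeff_region_def)
qed

lemma boundary_grid_bound:
  assumes "d \<ge> 1"
  obtains C :: real where "\<And>B. B \<ge> 1 \<Longrightarrow> real (card (boundary_grid d s B)) \<le> C * B ^ d"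
proof -
  obtain C where C: "C \<ge> 0" "\<And>B. B \<ge> 1 \<Longrightarrow> real (card (double_root_grid d B)) \<le> C * B ^ d"
    using double_root_grid_bound[OF assms] by blast
  have "real (card (boundary_grid d s B)) \<le> (real (d + 1) * 3 * 4 ^ d + 2 * C) * B ^ d" if B: "B \<ge> 1" for B
  proof -
    let ?D = "double_root_grid d B"
    have fin: "finite ?D" "finite (face_grid d B)"
      by (auto simp: double_root_grid_def face_grid_def)
    have "card (boundary_grid d s B) \<le> card (face_grid d B \<union> ?D \<union> reflect d ` ?D)"
      using boundary_grid_cases[OF B] fin by (intro card_mono) auto
    also have "\<dots> \<le> card (face_grid d B) + card ?D + card ?D"
      using card_Un_le[of "face_grid d B \<union> ?D" "reflect d ` ?D"] card_Un_le[of "face_grid d B" ?D]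
        card_image_le[OF fin(1), of "reflect d"] by linarith
    finally have "real (card (boundary_grid d s B)) \<le> card (face_grid d B) + 2 * card ?D" by linarith
    also have "\<dots> \<le> (real (d + 1) * 3 * 4 ^ d) * B ^ d + 2 * (C * B ^ d)"
      using face_grid_bound[OF B, of d] C(2)[OF B] by (simp add: add_mono)
    finally show ?thesis by (simp add: algebra_simps)
  qed
  then show thesis by (rule that)
qed

section \<open>Volume and lattice points\<close>

definition inner_grid :: "nat \<Rightarrow> nat \<Rightarrow> real \<Rightarrow> (nat \<Rightarrow> int) set" where
  "inner_grid d s B = {a \<in> grid d B. cube d B a \<subseteq> coeff_region d s}"

definition outer_grid :: "nat \<Rightarrow> nat \<Rightarrow> real \<Rightarrow> (nat \<Rightarrow> int) set" where
  "outer_grid d s B = {a \<in> grid d B. cube d B a \<inter> coeff_region d s \<noteq> {}}"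

text \<open>Each half-open cube contains its lower corner, which is what lets integer points be
  counted by cubes.\<close>

lemma corner_in_cube: "B > 0 \<Longrightarrow> (\<lambda>i. a i / B) \<in> cube d B a"
  by (simp add: cube_def)

lemma inner_grid_subset_outer_grid: "B > 0 \<Longrightarrow> inner_grid d s B \<subseteq> outer_grid d s B"
  unfolding inner_grid_def outer_grid_def using corner_in_cube by blast

lemma boundary_grid_eq: "boundary_grid d s B = outer_grid d s B - inner_grid d s B"
  by (auto simp: boundary_grid_def inner_grid_def outer_grid_def)

lemma finite_inner_outer_grid [simp]: "finite (inner_grid d s B)" "finite (outer_grid d s B)"
  by (simp_all add: inner_grid_def outer_grid_def)

lemma floor_in_grid:
  assumes "B > 0" "\<And>i. i \<le> d \<Longrightarrow> \<bar>p i\<bar> \<le> 1"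
  shows "(\<lambda>i\<in>{..d}. \<lfloor>B * p i\<rfloor>) \<in> grid d B"
proof -
  have "\<lfloor>B * p i\<rfloor> \<in> side B" if "i \<le> d" for i
  proof -
    have "B * p i \<le> B" "- B \<le> B * p i"
      using assms(1) assms(2)[OF that] mult_left_mono[of "p i" 1 B] mult_left_mono[of "-1" "p i" B]
      by (auto simp: abs_le_iff)
    then show ?thesis by (auto simp: side_def intro: floor_mono)
  qed
  then show ?thesis by (auto simp: grid_def)
qed

section \<open>Measure of unions of cubes and measurability of the region\<close>

definition box_measure :: "nat \<Rightarrow> (nat \<Rightarrow> real) measure" where
  "box_measure d = PiM {..d} (\<lambda>_. lborel)"

definition ext_cube :: "nat \<Rightarrow> real \<Rightarrow> (nat \<Rightarrow> int) \<Rightarrow> (nat \<Rightarrow> real) set" where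
  "ext_cube d B a = cube d B a \<inter> PiE {..d} (\<lambda>_. UNIV)"

lemma ext_cube_eq:
  assumes "B > 0"
  shows "ext_cube d B a = PiE {..d} (\<lambda>i. {a i / B..<(a i + 1) / B})"
proof -
  have "\<lfloor>B * t\<rfloor> = k \<longleftrightarrow> t \<in> {k / B..<(k + 1) / B}" for t k
    using assms by (auto simp: floor_eq_iff field_simps)
  then show ?thesis by (auto simp: ext_cube_def cube_def PiE_iff)
qed

lemma ext_cube_measure:
  assumes "B > 0"
  shows "ext_cube d B a \<in> sets (box_measure d)"
    and "emeasure (box_measure d) (ext_cube d B a) = ennreal ((1 / B) ^ (d + 1))"
proof -
  interpret product_sigma_finite "\<lambda>_::nat. lborel :: real measure" ..
  show "ext_cube d B a \<in> sets (box_measure d)"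
    unfolding ext_cube_eq[OF assms] box_measure_def by (intro sets_PiM_I_finite) auto
  have "emeasure (box_measure d) (ext_cube d B a) = (\<Prod>i\<le>d. emeasure lborel {a i / B..<(a i + 1) / B})"
    unfolding ext_cube_eq[OF assms] box_measure_def by (subst emeasure_PiM) auto
  also have "\<dots> = (\<Prod>i\<le>d. ennreal (1 / B))"
    using assms by (intro prod.cong) (auto simp: divide_right_mono diff_divide_distrib[symmetric])
  also have "\<dots> = ennreal ((1 / B) ^ (d + 1))"
    using assms by (simp add: ennreal_power del: power_Suc)
  finally show "emeasure (box_measure d) (ext_cube d B a) = ennreal ((1 / B) ^ (d + 1))" .
qed

lemma ext_cube_disjoint:
  assumes "a \<in> grid d B" "b \<in> grid d B" "ext_cube d B a \<inter> ext_cube d B b \<noteq> {}"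
  shows "a = b"
proof
  fix i show "a i = b i"
    using assms by (cases "i \<le> d") (auto simp: ext_cube_def cube_def grid_def PiE_iff extensional_def)
qed

lemma ext_cubes_measure:
  assumes "B > 0" "S \<subseteq> grid d B"
  shows "(\<Union>a\<in>S. ext_cube d B a) \<in> sets (box_measure d)"
    and "emeasure (box_measure d) (\<Union>a\<in>S. ext_cube d B a) = ennreal (card S * (1 / B) ^ (d + 1))"
proof -
  have fin: "finite S" using assms(2) finite_grid finite_subset by blast
  show "(\<Union>a\<in>S. ext_cube d B a) \<in> sets (box_measure d)"
    using fin ext_cube_measure(1)[OF assms(1)] by auto
  have "emeasure (box_measure d) (\<Union>a\<in>S. ext_cube d B a) = (\<Sum>a\<in>S. emeasure (box_measure d) (ext_cube d B a))"
    using fin ext_cube_measure(1)[OF assms(1)] ext_cube_disjoint assms(2)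
    by (intro sum_emeasure[symmetric]) (auto simp: disjoint_family_on_def, blast)
  also have "\<dots> = (\<Sum>a\<in>S. ennreal ((1 / B) ^ (d + 1)))"
    by (simp only: ext_cube_measure(2)[OF assms(1)])
  also have "\<dots> = ennreal (card S * (1 / B) ^ (d + 1))"
    using assms(1) by (simp add: ennreal_mult ennreal_of_nat_eq_real_of_nat del: power_Suc)
  finally show "emeasure (box_measure d) (\<Union>a\<in>S. ext_cube d B a) = ennreal (card S * (1 / B) ^ (d + 1))" .
qed

lemma H_set_eq: "H_set d s 1 = coeff_region d s \<inter> PiE {..d} (\<lambda>_. UNIV)"
  by (auto simp: H_set_def coeff_region_def coeff_poly_def lessThan_Suc_atMost)

lemma H_set_sandwich:
  assumes "B > 0"
  shows "(\<Union>a\<in>inner_grid d s B. ext_cube d B a) \<subseteq> H_set d s 1"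
    and "H_set d s 1 \<subseteq> (\<Union>a\<in>outer_grid d s B. ext_cube d B a)"
proof -
  show "(\<Union>a\<in>inner_grid d s B. ext_cube d B a) \<subseteq> H_set d s 1"
    by (auto simp: inner_grid_def ext_cube_def H_set_eq)
  show "H_set d s 1 \<subseteq> (\<Union>a\<in>outer_grid d s B. ext_cube d B a)"
  proof
    fix p assume p: "p \<in> H_set d s 1"
    let ?a = "\<lambda>i\<in>{..d}. \<lfloor>B * p i\<rfloor>"
    have "?a \<in> grid d B"
      using p assms by (intro floor_in_grid) (auto simp: H_set_eq coeff_region_def)
    moreover have "p \<in> cube d B ?a" by (simp add: cube_def)
    ultimately show "p \<in> (\<Union>a\<in>outer_grid d s B. ext_cube d B a)"
      using p by (intro UN_I[of ?a]) (auto simp: outer_grid_def ext_cube_def H_set_eq)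
  qed
qed

text \<open>The sandwich with \<open>B \<rightarrow> \<infinity>\<close> shows that the region differs from a Borel set by a subset of a
  null set.\<close>

lemma H_set_measurable:
  assumes "d \<ge> 1"
  shows "H_set d s 1 \<in> sets (completion (box_measure d))"
proof -
  define I where "I n = (\<Union>a\<in>inner_grid d s (real (Suc n)). ext_cube d (real (Suc n)) a)" for n
  define O' where "O' n = (\<Union>a\<in>outer_grid d s (real (Suc n)). ext_cube d (real (Suc n)) a)" for n
  have meas: "I n \<in> sets (box_measure d)" "O' n \<in> sets (box_measure d)" for n
    unfolding I_def O'_def by (intro ext_cubes_measure; auto simp: inner_grid_def outer_grid_def)+
  have sand: "I n \<subseteq> H_set d s 1" "H_set d s 1 \<subseteq> O' n" for n
    unfolding I_def O'_def by (intro H_set_sandwich; simp)+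
  obtain C where C: "\<And>B. B \<ge> 1 \<Longrightarrow> real (card (boundary_grid d s B)) \<le> C * B ^ d"
    using boundary_grid_bound[OF assms] by blast
  define L where "L = (\<Union>n. I n)"
  define U where "U = (\<Inter>n. O' n)"
  have LU: "L \<in> sets (box_measure d)" "U \<in> sets (box_measure d)" "L \<subseteq> H_set d s 1" "H_set d s 1 \<subseteq> U"
    unfolding L_def U_def using meas sand(1) by (auto dest: subsetD[OF sand(2)])
  \<comment> \<open>The difference is covered by the boundary cubes of scale \<open>Suc n\<close>:
    at most \<open>C * ?B ^ d\<close> of them, each of volume
    \<open>(1 / ?B) ^ (d + 1)\<close>.\<close>
  have small: "emeasure (box_measure d) (U - L) \<le> ennreal (C / real (Suc n))" for n
  proof -
    let ?B = "real (Suc n)"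
    let ?D = "\<Union>a\<in>boundary_grid d s ?B. ext_cube d ?B a"
    have bg: "boundary_grid d s ?B \<subseteq> grid d ?B" by (auto simp: boundary_grid_def)
    have "U - L \<subseteq> O' n - I n" by (auto simp: U_def L_def)
    also have "\<dots> \<subseteq> ?D" by (auto simp: O'_def I_def boundary_grid_eq)
    finally have "emeasure (box_measure d) (U - L) \<le> emeasure (box_measure d) ?D"
      using ext_cubes_measure(1)[OF _ bg] by (intro emeasure_mono) auto
    also have "\<dots> = ennreal (card (boundary_grid d s ?B) * (1 / ?B) ^ (d + 1))"
      by (intro ext_cubes_measure(2) bg) auto
    also have "\<dots> \<le> ennreal (C * ?B ^ d * (1 / ?B) ^ (d + 1))"
      using C[of ?B] by (intro ennreal_leI mult_right_mono) auto
    also have "C * ?B ^ d * (1 / ?B) ^ (d + 1) = C / ?B"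
      by (simp add: power_divide)
    finally show ?thesis .
  qed
  have "(\<lambda>n. ennreal (C / real (Suc n))) \<longlonglongrightarrow> ennreal 0"
    using LIMSEQ_Suc[OF lim_const_over_n[of C]] by (intro tendsto_ennrealI) simp
  then have "emeasure (box_measure d) (U - L) \<le> 0"
    using small by (intro LIMSEQ_le_const[where X = "\<lambda>n. ennreal (C / real (Suc n))"]) auto
  then have "U - L \<in> null_sets (box_measure d)" using LU by (auto simp: null_sets_def)
  then show ?thesis
    using LU by (intro sets_completionI[of _ L "H_set d s 1 - L" "U - L"]) auto
qed

lemma lebesgue_n_eq: "lebesgue_n (d + 1) = completion (box_measure d)"
  by (simp add: lebesgue_n_def box_measure_def lessThan_Suc_atMost)

lemma measure_H_set_bounds:
  assumes "d \<ge> 1" "B > 0"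
  shows "card (inner_grid d s B) * (1 / B) ^ (d + 1) \<le> measure (lebesgue_n (d + 1)) (H_set d s 1)"
    and "measure (lebesgue_n (d + 1)) (H_set d s 1) \<le> card (outer_grid d s B) * (1 / B) ^ (d + 1)"
proof -
  have sub: "inner_grid d s B \<subseteq> grid d B" "outer_grid d s B \<subseteq> grid d B"
    by (auto simp: inner_grid_def outer_grid_def)
  have em: "emeasure (completion (box_measure d)) (\<Union>a\<in>S. ext_cube d B a) = ennreal (card S * (1 / B) ^ (d + 1))"
    if "S \<subseteq> grid d B" for S
    using ext_cubes_measure[OF assms(2) that] by simp
  have me: "measure (completion (box_measure d)) (\<Union>a\<in>S. ext_cube d B a) = card S * (1 / B) ^ (d + 1)"
    if "S \<subseteq> grid d B" for S
    using em[OF that] assms(2) by (simp add: measure_def)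
  have fm: "(\<Union>a\<in>S. ext_cube d B a) \<in> fmeasurable (completion (box_measure d))" if "S \<subseteq> grid d B" for S
    using em[OF that] ext_cubes_measure(1)[OF assms(2) that] by (intro fmeasurableI) auto
  \<comment> \<open>The outer cubes give a cover of finite measure. Without finiteness monotonicity
    could fail, as \<open>measure\<close> is 0 on sets of infinite measure.\<close>
  have H: "H_set d s 1 \<in> fmeasurable (completion (box_measure d))"
    by (rule fmeasurableI2[OF fm[OF sub(2)] H_set_sandwich(2)[OF assms(2)] H_set_measurable[OF assms(1)]])
  show "card (inner_grid d s B) * (1 / B) ^ (d + 1) \<le> measure (lebesgue_n (d + 1)) (H_set d s 1)"
    unfolding me[OF sub(1), symmetric] lebesgue_n_eq
    using H_set_sandwich(1)[OF assms(2)] fm[OF sub(1)] H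
    by (intro measure_mono_fmeasurable) (auto dest: fmeasurableD)
  show "measure (lebesgue_n (d + 1)) (H_set d s 1) \<le> card (outer_grid d s B) * (1 / B) ^ (d + 1)"
    unfolding me[OF sub(2), symmetric] lebesgue_n_eq
    using H_set_sandwich(2)[OF assms(2)] fm[OF sub(2)] H
    by (intro measure_mono_fmeasurable) (auto dest: fmeasurableD)
qed


section \<open>Integer polynomials as corners of cubes\<close>

text \<open>Dividing an integer coefficient vector by \<open>B\<close> gives the corner of a cube
  and turns the bound \<open>B\<close> into 1; the signature is unchanged by the factor
  \<open>1 / B\<close>.\<close>

lemma D_star_eq:
  assumes "B > 0"
  shows "D_star d s B = card {a \<in> grid d B. (\<lambda>i. a i / B) \<in> coeff_region d s}"
proof -
  define X where "X = {P :: int poly. degree P = d \<and> coeff P d \<noteq> 0 \<and>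
     (\<forall>i\<le>d. \<bar>real_of_int (coeff P i)\<bar> \<le> B) \<and> has_signature (map_poly real_of_int P) s}"
  define Y where "Y = {a \<in> grid d B. (\<lambda>i. a i / B) \<in> coeff_region d s}"
  define f where "f P = (\<lambda>i\<in>{..d}. coeff P i)" for P :: "int poly"
  define g where "g a = (\<Sum>i\<le>d. monom (a i) i)" for a :: "nat \<Rightarrow> int"
  have sig: "has_signature (coeff_poly d (\<lambda>i. real_of_int (a i) / B)) s \<longleftrightarrow>
      has_signature (coeff_poly d (\<lambda>i. real_of_int (a i))) s" for a :: "nat \<Rightarrow> int"
    using coeff_poly_scale[of d "1 / B" "\<lambda>i. real_of_int (a i)"] has_signature_smult[of "1 / B"] assms by simp
  have abs: "\<bar>real_of_int k / B\<bar> \<le> 1 \<longleftrightarrow> \<bar>real_of_int k\<bar> \<le> B" for k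
    using assms by (simp add: abs_divide)
  have side: "k \<in> side B" if "\<bar>real_of_int k\<bar> \<le> B" for k
  proof -
    have "\<lfloor>- B\<rfloor> \<le> \<lfloor>real_of_int k\<rfloor>" using that by (intro floor_mono) auto
    then show ?thesis using that by (auto simp: side_def le_floor_iff)
  qed
  have cg: "coeff (g a) i = (if i \<le> d then a i else 0)" for a i
    by (simp add: g_def coeff_sum)
  have mpg: "map_poly real_of_int (g a) = coeff_poly d (\<lambda>i. real_of_int (a i))" for a
    by (intro poly_eqI) (simp add: coeff_coeff_poly coeff_map_poly cg)
  have gf: "g (f P) = P" if "degree P = d" for P
    using that by (intro poly_eqI) (auto simp: cg f_def coeff_eq_0)
  have dg: "degree (g a) = d" if "a d \<noteq> 0" for a
    using that by (intro antisym degree_le le_degree) (auto simp: cg)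
  have "bij_betw f X Y"
  proof (rule bij_betw_byWitness[where f' = g])
    show "\<forall>P\<in>X. g (f P) = P" using gf by (auto simp: X_def)
    show "\<forall>a\<in>Y. f (g a) = a"
      by (auto simp: Y_def f_def cg grid_def PiE_iff extensional_def fun_eq_iff)
    show "f ` X \<subseteq> Y"
    proof
      fix a assume "a \<in> f ` X"
      then obtain P where P: "P \<in> X" "a = f P" by auto
      have "has_signature (coeff_poly d (\<lambda>i. real_of_int (f P i))) s"
        using P gf[of P] mpg[of "f P"] by (simp add: X_def)
      moreover have "f P \<in> grid d B" using P side by (auto simp: grid_def f_def X_def)
      ultimately show "a \<in> Y"
        using P assms by (auto simp: Y_def coeff_region_def sig abs) (auto simp: f_def X_def)
    qed
    show "g ` Y \<subseteq> X"
    proof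
      fix P assume "P \<in> g ` Y"
      then obtain a where a: "a \<in> Y" "P = g a" by auto
      then have "a d \<noteq> 0" "has_signature (map_poly real_of_int (g a)) s" "\<forall>i\<le>d. \<bar>real_of_int (a i)\<bar> \<le> B"
        using assms by (auto simp: Y_def coeff_region_def sig abs mpg)
      then show "P \<in> X" using a(2) dg[of a] by (auto simp: X_def cg)
    qed
  qed
  then show ?thesis unfolding D_star_def X_def[symmetric] Y_def[symmetric] by (rule bij_betw_same_card)
qed

lemma D_star_bounds:
  assumes "B > 0"
  shows "card (inner_grid d s B) \<le> D_star d s B" "D_star d s B \<le> card (outer_grid d s B)"
  unfolding D_star_eq[OF assms] using corner_in_cube[OF assms]
  by (intro card_mono; fastforce simp: inner_grid_def outer_grid_def)+

section \<open>An interior point of the region\<close>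

lemma coeff_region_interior:
  assumes "s \<le> d div 2"
  obtains p \<delta> where "\<delta> > 0" "p \<in> coeff_region d s"
    "\<And>q. (\<And>i. i \<le> d \<Longrightarrow> \<bar>q i - p i\<bar> < \<delta>) \<Longrightarrow> q \<in> coeff_region d s"
proof -
  define r where "r = d - 2 * s"
  have r: "r + 2 * s = d" using assms by (simp add: r_def)
  \<comment> \<open>The real roots 0, ..., \<open>r - 1\<close> are simple. The multiple roots of
    the second factor are non-real and do no harm.\<close>
  define P where "P = (\<Prod>j<r. [:- real j, 1:]) * [:1, 0, 1:] ^ s"
  \<comment> \<open>The scaling brings all coefficients down to at most 1/2, so that perturbations
    below 1/2 stay in the box; the summand 1 keeps the denominator positive.\<close>
  define c where "c = 1 / (2 * (1 + (\<Sum>i\<le>d. \<bar>coeff P i\<bar>)))"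
  define p where "p i = c * coeff P i" for i
  have c: "c > 0" unfolding c_def by (auto intro!: divide_pos_pos add_pos_nonneg sum_nonneg)
  have P0: "P \<noteq> 0" by (auto simp: P_def)
  have deg: "degree P = d"
    using r by (simp add: P_def degree_mult_eq degree_prod_eq_sum_degree degree_power_eq)
  have roots: "poly P x = 0 \<longleftrightarrow> x \<in> real ` {..<r}" for x
  proof -
    have "1 + x * x \<noteq> 0" by (metis add_pos_nonneg less_irrefl zero_le_square zero_less_one)
    then show ?thesis by (auto simp: P_def poly_prod)
  qed
  have simple: "poly (pderiv P) x \<noteq> 0" if "poly P x = 0" for x
  proof -
    obtain j where j: "j < r" "x = real j" using \<open>poly P x = 0\<close> roots by auto
    \<comment> \<open>Removing the factor of the root \<open>x\<close> leaves \<open>Q\<close>, and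
      the derivative of \<open>P\<close> at \<open>x\<close> is the nonzero value of
      \<open>Q\<close> there.\<close>
    define Q where "Q = (\<Prod>i\<in>{..<r} - {j}. [:- real i, 1:]) * [:1, 0, 1:] ^ s"
    have PQ: "P = [:- x, 1:] * Q"
      using prod.remove[of "{..<r}" j "\<lambda>i. [:- real i, 1:]"] j
      by (simp only: P_def Q_def mult.assoc finite_lessThan lessThan_iff)
    have "1 + x * x \<noteq> 0" by (metis add_pos_nonneg less_irrefl zero_le_square zero_less_one)
    then have "poly Q x \<noteq> 0" by (auto simp: Q_def poly_prod j)
    then show ?thesis unfolding PQ pderiv_mult by (simp add: pderiv_pCons)
  qed
  have cp: "coeff_poly d p = smult c P"
    using deg by (intro poly_eqI) (auto simp: coeff_coeff_poly p_def coeff_eq_0)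
  have pd: "p d \<noteq> 0" using c P0 deg by (auto simp: p_def)
  have ndr: "\<not> double_root d p x" for x
    using simple[of x] c by (auto simp: double_root_def cp pderiv_smult)
  have "{x. poly (coeff_poly d p) x = 0} = real ` {..<r}" using c roots by (auto simp: cp)
  then have card: "card {x. poly (coeff_poly d p) x = 0} = r" by (simp add: card_image)
  have half: "\<bar>p i\<bar> \<le> 1 / 2" if "i \<le> d" for i
  proof -
    have "\<bar>coeff P i\<bar> \<le> (\<Sum>i\<le>d. \<bar>coeff P i\<bar>)" using that by (intro member_le_sum) auto
    then have "\<bar>p i\<bar> \<le> c * (1 + (\<Sum>i\<le>d. \<bar>coeff P i\<bar>))"
      using c by (auto simp: p_def abs_mult)
    also have "\<dots> = 1 / 2"
    proof -
      have "(\<Sum>i\<le>d. \<bar>coeff P i\<bar>) \<ge> 0" by (intro sum_nonneg) auto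
      then have "1 + (\<Sum>i\<le>d. \<bar>coeff P i\<bar>) \<noteq> 0" by linarith
      then show ?thesis by (simp add: c_def del: distrib_left_numeral)
    qed
    finally show ?thesis .
  qed
  obtain \<delta> where \<delta>: "\<delta> > 0"
    "\<And>q. (\<And>i. i \<le> d \<Longrightarrow> \<bar>q i - p i\<bar> < \<delta>) \<Longrightarrow> q d \<noteq> 0 \<and> (\<forall>x. \<not> double_root d q x) \<and>
       card {x. poly (coeff_poly d q) x = 0} = card {x. poly (coeff_poly d p) x = 0}"
    using card_real_roots_stable[OF pd ndr] by blast
  have near: "q \<in> coeff_region d s" if q: "\<And>i. i \<le> d \<Longrightarrow> \<bar>q i - p i\<bar> < min \<delta> (1 / 2)" for q
  proof -
    have *: "q d \<noteq> 0" "\<forall>x. \<not> double_root d q x" "card {x. poly (coeff_poly d q) x = 0} = r"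
      using \<delta>(2)[of q] q card by auto
    then have "has_signature (coeff_poly d q) s"
      using has_signature_coeff_poly_iff[of q d s] r by auto
    moreover have "\<bar>q i\<bar> \<le> 1" if "i \<le> d" for i
      using q[OF that] half[OF that] unfolding min_less_iff_conj by linarith
    ultimately show ?thesis using * by (auto simp: coeff_region_def)
  qed
  show thesis
    by (rule that[of "min \<delta> (1 / 2)" p]) (use \<delta> near in auto)
qed

text \<open>Once \<open>1 / B \<le> \<delta>\<close>, the cube around the interior point stays
  within \<open>\<delta>\<close> of it. One such cube already forces positive volume.\<close>

lemma inner_grid_nonempty:
  assumes "s \<le> d div 2"
  obtains B where "B \<ge> 1" "inner_grid d s B \<noteq> {}"
proof -
  obtain p \<delta> where \<delta>: "\<delta> > 0" "p \<in> coeff_region d s"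
    "\<And>q. (\<And>i. i \<le> d \<Longrightarrow> \<bar>q i - p i\<bar> < \<delta>) \<Longrightarrow> q \<in> coeff_region d s"
    using coeff_region_interior[OF assms] by blast
  define B where "B = max 1 (1 / \<delta>)"
  have B: "B \<ge> 1" "1 / B \<le> \<delta>" using \<delta>(1) by (auto simp: B_def field_simps max_def)
  let ?a = "\<lambda>i\<in>{..d}. \<lfloor>B * p i\<rfloor>"
  have "?a \<in> grid d B"
    using \<delta>(2) B by (intro floor_in_grid) (auto simp: coeff_region_def)
  moreover have "cube d B ?a \<subseteq> coeff_region d s"
  proof
    fix q assume q: "q \<in> cube d B ?a"
    show "q \<in> coeff_region d s"
    proof (rule \<delta>(3))
      fix i assume "i \<le> d"
      then have "\<lfloor>B * q i\<rfloor> = \<lfloor>B * p i\<rfloor>" using q by (simp add: cube_def)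
      then have "\<bar>B * q i - B * p i\<bar> < 1" by linarith
      then have "B * \<bar>q i - p i\<bar> < 1"
        using B by (simp add: abs_mult flip: right_diff_distrib)
      then have "\<bar>q i - p i\<bar> < 1 / B"
        using B by (simp add: pos_less_divide_eq mult.commute)
      then show "\<bar>q i - p i\<bar> < \<delta>" using B by linarith
    qed
  qed
  ultimately show thesis using B by (intro that[of B]) (auto simp: inner_grid_def)
qed

theorem theorem2p1:
  fixes d s :: nat
  assumes "d \<ge> 1" and "s \<le> d div 2"
  shows "(\<exists>C::real. \<forall>B::real. B \<ge> 1 \<longrightarrow>
           \<bar>real (D_star d s B) - measure (lebesgue_n (d + 1)) (H_set d s 1) * B ^ (d + 1)\<bar>
             \<le> C * B ^ d)
         \<and> measure (lebesgue_n (d + 1)) (H_set d s 1) > 0"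
proof
  let ?\<mu> = "measure (lebesgue_n (d + 1)) (H_set d s 1)"
  obtain C where C: "\<And>B. B \<ge> 1 \<Longrightarrow> real (card (boundary_grid d s B)) \<le> C * B ^ d"
    using boundary_grid_bound[OF assms(1)] by blast
  show "\<exists>C::real. \<forall>B::real. B \<ge> 1 \<longrightarrow> \<bar>real (D_star d s B) - ?\<mu> * B ^ (d + 1)\<bar> \<le> C * B ^ d"
  proof (intro exI[of _ C] allI impI)
    fix B :: real assume B: "B \<ge> 1"
    then have "B > 0" by simp
    note bounds = measure_H_set_bounds[OF assms(1) \<open>B > 0\<close>, of s]
    have cancel: "(1 / B) ^ (d + 1) * B ^ (d + 1) = 1"
      using B by (simp add: power_divide)
    have "real (card (inner_grid d s B)) \<le> ?\<mu> * B ^ (d + 1)"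
      using mult_right_mono[OF bounds(1), of "B ^ (d + 1)"] \<open>B > 0\<close>
      by (simp only: mult.assoc cancel mult_1_right zero_le_power less_imp_le)
    moreover have "?\<mu> * B ^ (d + 1) \<le> real (card (outer_grid d s B))"
      using mult_right_mono[OF bounds(2), of "B ^ (d + 1)"] \<open>B > 0\<close>
      by (simp only: mult.assoc cancel mult_1_right zero_le_power less_imp_le)
    moreover have "real (card (boundary_grid d s B)) = real (card (outer_grid d s B)) - real (card (inner_grid d s B))"
      unfolding boundary_grid_eq using inner_grid_subset_outer_grid[OF \<open>B > 0\<close>, of d s]
      by (simp add: card_Diff_subset card_mono of_nat_diff)
    moreover have "real (card (inner_grid d s B)) \<le> real (D_star d s B)"
      "real (D_star d s B) \<le> real (card (outer_grid d s B))"
      using D_star_bounds[OF \<open>B > 0\<close>, of d s] by simp_all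
    \<comment> \<open>Both quantities lie between the inner and the outer count, so they differ by
      at most the number of boundary cubes.\<close>
    ultimately show "\<bar>real (D_star d s B) - ?\<mu> * B ^ (d + 1)\<bar> \<le> C * B ^ d"
      using C[OF B] by linarith
  qed
  obtain B where B: "B \<ge> 1" "inner_grid d s B \<noteq> {}"
    using inner_grid_nonempty[OF assms(2)] .
  have "0 < card (inner_grid d s B) * (1 / B) ^ (d + 1)"
    using B by (simp add: card_gt_0_iff del: power_Suc)
  also have "\<dots> \<le> ?\<mu>" using B by (intro measure_H_set_bounds(1) assms) auto
  finally show "?\<mu> > 0" .
qed

end
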